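(* Let $G$ be a connected graph of order $n\geq 16$ and let $\mathcal{G}_1=\{K_{n-4}\vee 4K_1,\ K_{n-4}\vee(2K_1\cup K_2),\ K_{n-4}\vee(P_3\cup K_1),\ K_{n-4}\vee 2K_2,\ K_{n-4}\vee P_4,\ K_{n-4}\vee(K_3\cup K_1),\ K_{n-4}\vee C_4\}$. Then $m(-1)=n-5$ if and only if $G\in\mathcal{G}_1\cup\{K_{n-5}\vee C_5,\ K_{n-5}\vee(K_1\cup P_4),\ K_{n-5}\vee H_1\}$, where $H_1$ is the bull graph. In addition, each such $G$ is determined by its $\mathcal{A}$-spectrum.
   Context: $K_m,P_m,C_m$ are the complete graph, path, cycle on $m$ vertices; $kH$ is the disjoint union of $k$ copies of $H$; $\cup$ is disjoint union and $\vee$ is join. The bull graph $H_1$ has vertices $a,b,c,x,y$ and edges $ab,bc,ca,xa,yb$. For a connected graph $G$, $d(u,v)$ is the distance and $\varepsilon(v)=\max_u d(u,v)$ the eccentricity. The eccentricity matrix $\mathcal{A}(G)$ is indexed by $V(G)$ with $(u,v)$-entry $d(u,v)$ if $d(u,v)=\min\{\varepsilon(u),\varepsilon(v)\}$ and $0$ otherwise; its $\mathcal{A}$-spectrum is the multiset of its eigenvalues. $m(-1)$ is the multiplicity of $-1$ in the $\mathcal{A}$-spectrum. A graph $G$ is determined by its $\mathcal{A}$-spectrum if every connected graph with the same $\mathcal{A}$-spectrum is isomorphic to $G$. *)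

theory Defs
  imports
    "Graph_Theory.Graph_Theory"
    "Jordan_Normal_Form.Char_Poly"
begin

text \<open>
  A finite simple graph is a \<open>pair_graph\<close>, i.e. a finite loop-free symmetric digraph
  whose arcs are pairs of vertices. An undirected edge \<open>uv\<close> is the pair of arcs
  \<open>(u,v)\<close>, \<open>(v,u)\<close>.
\<close>

abbreviation graph_iso :: "'a pair_pre_digraph \<Rightarrow> 'b pair_pre_digraph \<Rightarrow> bool"
    (infix \<open>\<cong>\<^sub>g\<close> 50) where
  "G \<cong>\<^sub>g H \<equiv> digraph_iso (with_proj G) (with_proj H)"

abbreviation connected_graph :: "'a pair_pre_digraph \<Rightarrow> bool" where
  "connected_graph G \<equiv> pair_graph G \<and> Digraph_Component.connected (with_proj G)"

section \<open>Named graphs and operations\<close>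

definition complete_graph :: "nat \<Rightarrow> nat pair_pre_digraph" where
  "complete_graph m = \<lparr> pverts = {..<m}, parcs = {(i, j). i < m \<and> j < m \<and> i \<noteq> j} \<rparr>"

definition path_graph :: "nat \<Rightarrow> nat pair_pre_digraph" where
  "path_graph m = \<lparr> pverts = {..<m},
     parcs = {(i, j). i < m \<and> j < m \<and> (j = i + 1 \<or> i = j + 1)} \<rparr>"

text \<open>A simple graph only for \<open>m \<ge> 3\<close>.\<close>

definition cycle_graph :: "nat \<Rightarrow> nat pair_pre_digraph" where
  "cycle_graph m = \<lparr> pverts = {..<m},
     parcs = {(i, j). i < m \<and> j < m \<and> (j = (i + 1) mod m \<or> i = (j + 1) mod m)} \<rparr>"

text \<open>The vertices \<open>a, b, c, x, y\<close> are \<open>0, 1, 2, 3, 4\<close>.\<close>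

definition bull_graph :: "nat pair_pre_digraph" where
  "bull_graph =
    (let E = {(0, 1), (1, 2), (2, 0), (3, 0), (4, 1)}
     in \<lparr> pverts = {..<5}, parcs = E \<union> E\<inverse> \<rparr>)"

definition disjoint_union ::
    "'a pair_pre_digraph \<Rightarrow> 'b pair_pre_digraph \<Rightarrow> ('a + 'b) pair_pre_digraph"
    (infixr \<open>\<union>\<^sub>g\<close> 65) where
  "G \<union>\<^sub>g H = \<lparr> pverts = pverts G <+> pverts H,
     parcs = map_prod Inl Inl ` parcs G \<union> map_prod Inr Inr ` parcs H \<rparr>"

definition graph_join ::
    "'a pair_pre_digraph \<Rightarrow> 'b pair_pre_digraph \<Rightarrow> ('a + 'b) pair_pre_digraph"
    (infixr \<open>\<or>\<^sub>g\<close> 60) where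
  "G \<or>\<^sub>g H = \<lparr> pverts = pverts G <+> pverts H,
     parcs = parcs (G \<union>\<^sub>g H)
       \<union> (Inl ` pverts G) \<times> (Inr ` pverts H) \<union> (Inr ` pverts H) \<times> (Inl ` pverts G) \<rparr>"

definition copies :: "nat \<Rightarrow> 'a pair_pre_digraph \<Rightarrow> (nat \<times> 'a) pair_pre_digraph"
    (infixr \<open>\<cdot>\<^sub>g\<close> 70) where
  "k \<cdot>\<^sub>g G = \<lparr> pverts = {..<k} \<times> pverts G,
     parcs = {((i, u), (j, v)). i < k \<and> i = j \<and> (u, v) \<in> parcs G} \<rparr>"

section \<open>The eccentricity matrix and its spectrum\<close>

text \<open>
  \<open>wf_digraph.\<mu>\<close> is the infimum of the weights of all walks, here with unit weights.
  The conversion sends an infinite distance to \<open>0\<close>, so \<open>graph_dist\<close> is meaningful for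
  connected graphs only.
\<close>

definition graph_dist :: "'a pair_pre_digraph \<Rightarrow> 'a \<Rightarrow> 'a \<Rightarrow> real" where
  "graph_dist G u v = real_of_ereal (wf_digraph.\<mu> (with_proj G) (\<lambda>_. 1) u v)"

definition eccentricity :: "'a pair_pre_digraph \<Rightarrow> 'a \<Rightarrow> real" where
  "eccentricity G v = Max ((\<lambda>u. graph_dist G u v) ` pverts G)"

definition ecc_entry :: "'a pair_pre_digraph \<Rightarrow> 'a \<Rightarrow> 'a \<Rightarrow> real" where
  "ecc_entry G u v =
    (if graph_dist G u v = min (eccentricity G u) (eccentricity G v)
     then graph_dist G u v else 0)"

text \<open>
  Matrices are indexed by natural numbers, so the vertices are numbered by
  \<open>from_nat_into\<close>, a bijection from \<open>{..<card V}\<close> onto a finite set \<open>V\<close>. Another numbering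
  conjugates the matrix by a permutation matrix and does not change the spectrum.
\<close>

definition ecc_matrix :: "'a pair_pre_digraph \<Rightarrow> real mat" where
  "ecc_matrix G =
    (let n = card (pverts G); vert = from_nat_into (pverts G)
     in mat n n (\<lambda>(i, j). ecc_entry G (vert i) (vert j)))"

text \<open>
  The eigenvalues with their multiplicities as roots of the characteristic polynomial.
  The matrix is real symmetric, so the real roots are all of them and the algebraic and
  geometric multiplicities agree.
\<close>

definition A_spectrum :: "'a pair_pre_digraph \<Rightarrow> real multiset" where
  "A_spectrum G = proots (char_poly (ecc_matrix G))"

definition A_multiplicity :: "'a pair_pre_digraph \<Rightarrow> real \<Rightarrow> nat" where
  "A_multiplicity G x = count (A_spectrum G) x"

text \<open>
  A definition cannot quantify over the vertex type of the competing graphs \<open>H\<close>, hence the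
  type argument. Any infinite type, such as \<^typ>\<open>nat\<close>, already covers all finite graphs
  up to isomorphism.
\<close>

definition determined_by_A_spectrum :: "'b itself \<Rightarrow> 'a pair_pre_digraph \<Rightarrow> bool" where
  "determined_by_A_spectrum _ G \<longleftrightarrow>
    (\<forall>H :: 'b pair_pre_digraph.
       connected_graph H \<and> A_spectrum H = A_spectrum G \<longrightarrow> H \<cong>\<^sub>g G)"

section \<open>The graph families\<close>

text \<open>Membership in the families is up to isomorphism.\<close>

definition in_G1 :: "nat \<Rightarrow> 'a pair_pre_digraph \<Rightarrow> bool" where
  "in_G1 n G \<longleftrightarrow>
     G \<cong>\<^sub>g complete_graph (n - 4) \<or>\<^sub>g (4 \<cdot>\<^sub>g complete_graph 1) \<or>
     G \<cong>\<^sub>g complete_graph (n - 4) \<or>\<^sub>g ((2 \<cdot>\<^sub>g complete_graph 1) \<union>\<^sub>g complete_graph 2) \<or>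
     G \<cong>\<^sub>g complete_graph (n - 4) \<or>\<^sub>g (path_graph 3 \<union>\<^sub>g complete_graph 1) \<or>
     G \<cong>\<^sub>g complete_graph (n - 4) \<or>\<^sub>g (2 \<cdot>\<^sub>g complete_graph 2) \<or>
     G \<cong>\<^sub>g complete_graph (n - 4) \<or>\<^sub>g path_graph 4 \<or>
     G \<cong>\<^sub>g complete_graph (n - 4) \<or>\<^sub>g (complete_graph 3 \<union>\<^sub>g complete_graph 1) \<or>
     G \<cong>\<^sub>g complete_graph (n - 4) \<or>\<^sub>g cycle_graph 4"

definition in_extremal_family :: "nat \<Rightarrow> 'a pair_pre_digraph \<Rightarrow> bool" where
  "in_extremal_family n G \<longleftrightarrow>
     in_G1 n G \<or>
     G \<cong>\<^sub>g complete_graph (n - 5) \<or>\<^sub>g cycle_graph 5 \<or>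
     G \<cong>\<^sub>g complete_graph (n - 5) \<or>\<^sub>g (complete_graph 1 \<union>\<^sub>g path_graph 4) \<or>
     G \<cong>\<^sub>g complete_graph (n - 5) \<or>\<^sub>g bull_graph"

end

theory Submission
  imports
    Defs
    "HOL-Library.Sublist"
    "HOL-Number_Theory.Cong"
    "Jordan_Normal_Form.Jordan_Normal_Form_Existence"
    "Jordan_Normal_Form.Jordan_Normal_Form_Uniqueness"
begin

text \<open>
  Let \<open>N\<close> be the eccentricity matrix plus the identity, so that \<open>m(-1) = n - 5\<close> says
  \<open>rank N = 5\<close>. The vertices of a fixed eccentricity \<open>e \<ge> 2\<close> span a principal submatrix of \<open>N\<close>
  congruent to the identity modulo \<open>e\<close>, hence nonsingular; so every such class has at most 5
  elements. A geodesic of length at least 6 gives a nonsingular arrow-shaped principal submatrix of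
  order 6. Without a vertex of eccentricity 1 the eccentricities therefore lie in \<open>{2, 3, 4}\<close> or in
  \<open>{3, 4, 5}\<close>, and \<open>n \<le> 15\<close>. With a vertex of eccentricity 1, \<open>rank N = 1 + rank S\<close> where \<open>S\<close> is
  the Seidel matrix of the graph \<open>F\<close> induced on the vertices of eccentricity 2. These are at most 5
  in number; \<open>S\<close> is always nonsingular of order 4, and of order 5 it is singular only if \<open>F\<close> is
  switching equivalent to \<open>K\<^sub>1 \<union> P\<^sub>4\<close>. Finally, the sums of the second and third powers of the
  eigenvalues of \<open>N\<close> separate the members of the family, except \<open>F = P\<^sub>4\<close> from
  \<open>F = K\<^sub>3 \<union> K\<^sub>1\<close>; only the latter has the \<open>\<A>\<close>-eigenvalue 0.
\<close>


section \<open>Spectral decomposition of real symmetric matrices\<close>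

text \<open>Ranks enter only through two bounds on the multiplicity: a nonsingular principal
  submatrix of \<open>N\<close> of order k gives m(-1) \<le> n - k, and k rows of \<open>N\<close>
  whose vanishing forces that of all rows give m(-1) \<ge> n - k. If there is a universal vertex,
  then \<open>N\<close> = J + S with J all-ones and S extended by zeros; the row of a universal
  vertex is all-ones, and subtracting it isolates S, whence the summand 1 in the rank. Modulo 2 a
  Seidel matrix is J - I, whose determinant is -3 in order 4 but 4 in order 5, so singular matrices
  can first appear at five vertices. Switching multiplies rows and columns of S by signs and
  preserves the rank; it reduces the 1024 labelled graphs on five vertices to 64 with an isolated
  vertex. \<open>F\<close> never has a universal vertex, as that vertex would be universal in
  \<open>G\<close>, and this discards the other members of the switching class. The spectrum fixes
  the order and m(-1), so a cospectral mate already lies in the family. The bound 16 serves twice: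
  it exceeds the 15 of the case without a universal vertex, and it makes 3 n large enough to keep
  the third power sums apart.\<close>

lemma symmetric_real_eigenvalue:
  fixes A :: "real mat"
  assumes A: "A \<in> carrier_mat n n" and sym: "\<And>i j. i < n \<Longrightarrow> j < n \<Longrightarrow> A $$ (i, j) = A $$ (j, i)"
    and ev: "eigenvalue (map_mat complex_of_real A) a"
  shows "a \<in> \<real>"
proof -
  let ?A = "map_mat complex_of_real A"
  obtain v where v: "v \<in> carrier_vec n" "v \<noteq> 0\<^sub>v n" "?A *\<^sub>v v = a \<cdot>\<^sub>v v"
    using ev A unfolding eigenvalue_def eigenvector_def by auto
  have row: "(\<Sum>j<n. complex_of_real (A $$ (i, j)) * v $ j) = a * v $ i" if "i < n" for i
    using arg_cong[OF v(3), of "\<lambda>w. w $ i"] that v(1) A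
    by (simp add: scalar_prod_def lessThan_atLeast0)
  \<comment> \<open>For an eigenvector v, \<open>q\<close> = v* A v equals \<open>a\<close> times
    \<open>r\<close> = |v|^2. Symmetry makes \<open>q\<close> real, and \<open>r\<close> is real and
    nonzero, so \<open>a\<close> is real.\<close>
  define q where "q = (\<Sum>i<n. \<Sum>j<n. cnj (v $ i) * complex_of_real (A $$ (i, j)) * v $ j)"
  define r where "r = (\<Sum>i<n. cnj (v $ i) * v $ i)"
  have q: "q = a * r"
    unfolding q_def r_def sum_distrib_left
    by (intro sum.cong refl, subst mult.assoc, subst sum_distrib_left[symmetric])
      (simp add: row mult.assoc mult.left_commute)
  have "cnj q = (\<Sum>i<n. \<Sum>j<n. v $ i * complex_of_real (A $$ (i, j)) * cnj (v $ j))"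
    unfolding q_def by simp
  also have "\<dots> = (\<Sum>j<n. \<Sum>i<n. v $ i * complex_of_real (A $$ (i, j)) * cnj (v $ j))"
    by (rule sum.swap)
  also have "\<dots> = q"
    unfolding q_def by (intro sum.cong refl) (simp add: sym mult_ac)
  finally have "cnj q = q" .
  moreover have r: "r = complex_of_real (\<Sum>i<n. (cmod (v $ i))\<^sup>2)"
    unfolding r_def of_real_sum
    by (intro sum.cong refl) (metis complex_norm_square mult.commute of_real_power)
  moreover have "r \<noteq> 0"
  proof
    assume "r = 0"
    hence "(\<Sum>i<n. (cmod (v $ i))\<^sup>2) = 0" using r of_real_eq_0_iff by metis
    hence "\<And>i. i < n \<Longrightarrow> v $ i = 0" by (simp add: sum_nonneg_eq_0_iff)
    thus False using v(1,2) by auto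
  qed
  ultimately have "cnj a = a" using q by simp
  thus ?thesis by (simp add: Reals_cnj_iff)
qed

text \<open>A Jordan form over the reals requires linear factors. The complex factorization has only
  real roots, and the embedding of real polynomials into complex ones is injective, so it can be
  pulled back.\<close>

lemma symmetric_char_poly_splits:
  fixes A :: "real mat"
  assumes A: "A \<in> carrier_mat n n" and sym: "\<And>i j. i < n \<Longrightarrow> j < n \<Longrightarrow> A $$ (i, j) = A $$ (j, i)"
  shows "\<exists>es. char_poly A = (\<Prod>e\<leftarrow>es. [:- e, 1:])"
proof -
  let ?A = "map_mat complex_of_real A"
  have cA: "?A \<in> carrier_mat n n" using A by simp
  obtain as where as: "char_poly ?A = (\<Prod>a\<leftarrow>as. [:- a, 1:])"
    using char_poly_factorized[OF cA] by blast
  have real: "a \<in> \<real>" if "a \<in> set as" for a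
  proof (rule symmetric_real_eigenvalue[OF A sym])
    have "poly (char_poly ?A) a = 0"
      unfolding as using that by (auto simp: poly_prod_list prod_list_zero_iff)
    thus "eigenvalue ?A a" using eigenvalue_root_char_poly[OF cA] by simp
  qed
  interpret of_real: map_poly_inj_idom_hom complex_of_real ..
  have "map_poly complex_of_real (char_poly A) = char_poly ?A"
    by (rule of_real_hom.char_poly_hom[OF A, symmetric])
  also have "\<dots> = (\<Prod>a\<leftarrow>map (complex_of_real \<circ> Re) as. [:- a, 1:])"
    unfolding as using real by (intro arg_cong[of _ _ prod_list]) auto
  also have "\<dots> = map_poly complex_of_real (\<Prod>a\<leftarrow>map Re as. [:- a, 1:])"
    by (simp add: of_real.hom_prod_list o_def)
  finally have "char_poly A = (\<Prod>a\<leftarrow>map Re as. [:- a, 1:])"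
    by (simp only: of_real.eq_iff)
  thus ?thesis by blast
qed

lemma jordan_matrix_diagonal:
  "jordan_matrix (map (Pair 1) es) =
    mat (length es) (length es) (\<lambda>(i, j). if i = j then es ! i else 0)"
proof (induction es)
  case Nil
  show ?case by (auto simp: jordan_matrix_def)
next
  case (Cons e es)
  have "jordan_matrix (map (Pair 1) (e # es)) =
    (let B = jordan_matrix (map (Pair 1) es) in
      four_block_mat (jordan_block 1 e) (0\<^sub>m 1 (dim_col B)) (0\<^sub>m (dim_row B) 1) B)"
    by (simp add: jordan_matrix_def Let_def)
  thus ?case unfolding Let_def Cons.IH
    by (intro eq_matI) (auto simp: nth_Cons jordan_block_def split: nat.splits)
qed

text \<open>For symmetric A, |A v|^2 is the scalar product of v with A (A v), so A (A v) = 0 forces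
  A v = 0. Applied to A - a I, this excludes Jordan blocks of size above 1.\<close>

lemma symmetric_kernel_square:
  fixes A :: "real mat"
  assumes A: "A \<in> carrier_mat n n" and sym: "\<And>i j. i < n \<Longrightarrow> j < n \<Longrightarrow> A $$ (i, j) = A $$ (j, i)"
  shows "mat_kernel (A * A) = mat_kernel A"
proof (intro equalityI subsetI)
  fix v assume "v \<in> mat_kernel A"
  hence v: "v \<in> carrier_vec n" "A *\<^sub>v v = 0\<^sub>v n" using A mat_kernelD[OF A] by auto
  show "v \<in> mat_kernel (A * A)"
    by (rule mat_kernelI[of _ n n]) (use A v assoc_mult_mat_vec[OF A A v(1)] in auto)
next
  fix v assume "v \<in> mat_kernel (A * A)"
  hence v: "v \<in> carrier_vec n" "(A * A) *\<^sub>v v = 0\<^sub>v n" using A mat_kernelD[of "A*A" n n] by auto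
  have tA: "transpose_mat A = A" using A sym by auto
  let ?w = "A *\<^sub>v v"
  have w: "?w \<in> carrier_vec n" using A v by auto
  have "?w \<bullet> ?w = v \<bullet> (transpose_mat A *\<^sub>v ?w)"
    using transpose_vec_mult_scalar[OF A v(1) w] comm_scalar_prod[OF v(1), of "A *\<^sub>v ?w"] A w
    by (simp add: tA)
  also have "\<dots> = 0" using v assoc_mult_mat_vec[OF A A v(1)] by (simp add: tA)
  finally have "?w = 0\<^sub>v n"
    using conjugate_square_eq_0_vec[OF w] by simp
  thus "v \<in> mat_kernel A" by (intro mat_kernelI[OF A v(1)])
qed

theorem symmetric_diagonalizable:
  fixes A :: "real mat"
  assumes A: "A \<in> carrier_mat n n" and sym: "\<And>i j. i < n \<Longrightarrow> j < n \<Longrightarrow> A $$ (i, j) = A $$ (j, i)"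
  obtains es P Q where "length es = n" "P \<in> carrier_mat n n" "Q \<in> carrier_mat n n"
    "P * Q = 1\<^sub>m n" "Q * P = 1\<^sub>m n" "char_poly A = (\<Prod>e\<leftarrow>es. [:- e, 1:])"
    "A = P * mat n n (\<lambda>(i, j). if i = j then es ! i else 0) * Q"
proof -
  obtain n_as where jnf: "jordan_nf A n_as"
    using symmetric_char_poly_splits[OF A sym] jordan_nf_exists[OF A] by blast
  have one: "m = 1" if "(m, a) \<in> set n_as" for m a
  proof -
    let ?B = "char_matrix A a"
    have B: "?B \<in> carrier_mat n n" using A by simp
    have "mat_kernel (?B * ?B) = mat_kernel ?B"
      by (rule symmetric_kernel_square[OF B]) (use A sym in \<open>auto simp: char_matrix_def\<close>)
    hence "kernel_dim (?B ^\<^sub>m 2) = kernel_dim (?B ^\<^sub>m 1)"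
      using B by (simp add: kernel_dim_def numeral_2_eq_2)
    hence "dim_gen_eigenspace A a 2 = dim_gen_eigenspace A a 1"
      by (simp add: dim_gen_eigenspace_def)
    \<comment> \<open>A block of size k contributes min 2 k to the left side and min 1 k to the
      right side, so equality of the sums leaves only blocks of size 1.\<close>
    hence eq: "(\<Sum>k\<leftarrow>map fst [(k, e)\<leftarrow>n_as. e = a]. min 2 k) = (\<Sum>k\<leftarrow>map fst [(k, e)\<leftarrow>n_as. e = a]. min 1 k)"
      unfolding dim_gen_eigenspace[OF jnf] .
    have "\<forall>k\<in>set ks. min 2 k = min 1 k" if "(\<Sum>k\<leftarrow>ks. min 2 k) = (\<Sum>k\<leftarrow>ks. min 1 (k::nat))" for ks
      using that
    proof (induction ks)
      case (Cons k ks)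
      have "(\<Sum>k\<leftarrow>ks. min 1 k) \<le> (\<Sum>k\<leftarrow>ks. min 2 k)" by (rule sum_list_mono) auto
      hence "min 2 k = min 1 k \<and> (\<Sum>k\<leftarrow>ks. min 2 k) = (\<Sum>k\<leftarrow>ks. min 1 k)"
        using Cons.prems by (simp add: min_def split: if_splits)
      thus ?case using Cons.IH by auto
    qed simp
    from this[OF eq] have "min 2 m = min 1 m" using that by force
    moreover have "m \<noteq> 0" using jnf that unfolding jordan_nf_def by force
    ultimately show ?thesis by (simp add: min_def split: if_splits)
  qed
  define es where "es = map snd n_as"
  have n_as: "n_as = map (Pair 1) es"
    unfolding es_def map_map using one by (intro map_idI[symmetric]) auto
  let ?D = "mat (length es) (length es) (\<lambda>(i, j). if i = j then es ! i else 0)"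
  have "similar_mat A ?D"
    using jnf unfolding jordan_nf_def n_as jordan_matrix_diagonal by simp
  then obtain P Q where "similar_mat_wit A ?D P Q" unfolding similar_mat_def by blast
  note wit = similar_mat_witD2[OF A this]
  have len: "length es = n" using wit(5) by auto
  have "char_poly A = (\<Prod>e\<leftarrow>es. [:- e, 1:])"
    using jordan_nf_char_poly[OF jnf] by (simp add: n_as o_def)
  thus ?thesis using that[OF len wit(6,7,1,2)] wit(3) unfolding len by blast
qed

section \<open>Multiplicities, ranks and power sums\<close>

text \<open>Gaussian elimination, one equation at a time: a nonzero coefficient of equation
  \<open>k\<close> serves as pivot and removes the unknown \<open>p\<close>. Arbitrary finite index
  sets allow vertices and eigenvalue positions to be mixed; both bounds on multiplicities rest on
  it.\<close>

lemma underdetermined_system: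
  fixes a :: "'i \<Rightarrow> 'j \<Rightarrow> 'f :: field"
  assumes "finite I" "finite J" "card I < card J"
  shows "\<exists>x. (\<exists>j\<in>J. x j \<noteq> 0) \<and> (\<forall>i\<in>I. (\<Sum>j\<in>J. a i j * x j) = 0)"
  using assms
proof (induction I arbitrary: a J rule: finite_induct)
  case empty
  hence "J \<noteq> {}" by auto
  thus ?case by (intro exI[of _ "\<lambda>_. 1"]) auto
next
  case (insert k I)
  show ?case
  proof (cases "\<forall>j\<in>J. a k j = 0")
    case True
    have "card I < card J" using insert by auto
    from insert.IH[OF insert.prems(1) this, of a] show ?thesis using True by force
  next
    case False
    then obtain p where p: "p \<in> J" "a k p \<noteq> 0" by blast
    let ?J = "J - {p}"
    have "card I < card ?J" using insert p by simp
    from insert.IH[OF _ this, of "\<lambda>i j. a i j - a i p * a k j / a k p"] insert.prems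
    obtain x where x: "\<exists>j\<in>?J. x j \<noteq> 0"
      and eq: "\<And>i. i \<in> I \<Longrightarrow> (\<Sum>j\<in>?J. (a i j - a i p * a k j / a k p) * x j) = 0"
      by auto
    define s where "s = (\<Sum>j\<in>?J. a k j * x j)"
    define y where "y = x(p := - s / a k p)"
    have y: "(\<Sum>j\<in>J. a i j * y j) = (\<Sum>j\<in>?J. a i j * x j) - a i p * s / a k p" for i
    proof -
      have "(\<Sum>j\<in>J. a i j * y j) = a i p * y p + (\<Sum>j\<in>?J. a i j * y j)"
        using insert.prems p by (simp add: sum.remove)
      also have "(\<Sum>j\<in>?J. a i j * y j) = (\<Sum>j\<in>?J. a i j * x j)"
        by (intro sum.cong) (auto simp: y_def)
      finally show ?thesis by (simp add: y_def)
    qed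
    have "(\<Sum>j\<in>J. a i j * y j) = 0" if "i \<in> insert k I" for i
    proof (cases "i = k")
      case True
      thus ?thesis unfolding y using p by (simp add: s_def)
    next
      case False
      hence "i \<in> I" using that by simp
      have "(\<Sum>j\<in>?J. (a i j - a i p * a k j / a k p) * x j)
          = (\<Sum>j\<in>?J. a i j * x j) - (\<Sum>j\<in>?J. a i p / a k p * (a k j * x j))"
        unfolding sum_subtractf[symmetric] by (intro sum.cong) (auto simp: algebra_simps)
      also have "\<dots> = (\<Sum>j\<in>?J. a i j * x j) - a i p / a k p * s"
        by (simp add: s_def sum_distrib_left)
      finally show ?thesis unfolding y using eq[OF \<open>i \<in> I\<close>] by simp
    qed
    moreover have "\<exists>j\<in>J. y j \<noteq> 0" using x by (auto simp: y_def)
    ultimately show ?thesis by blast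
  qed
qed

section \<open>Symmetric matrices indexed by vertices\<close>

definition vertex_matrix :: "'a set \<Rightarrow> ('a \<Rightarrow> 'a \<Rightarrow> real) \<Rightarrow> real mat" where
  "vertex_matrix V a =
    mat (card V) (card V) (\<lambda>(i, j). a (from_nat_into V i) (from_nat_into V j))"

text \<open>The principal submatrix on \<open>W\<close> has trivial kernel. Sums over vertices keep
  numberings of \<open>W\<close> out of the statement.\<close>

definition nonsingular_on :: "'a set \<Rightarrow> ('a \<Rightarrow> 'a \<Rightarrow> real) \<Rightarrow> bool" where
  "nonsingular_on W a \<longleftrightarrow>
    (\<forall>x. (\<forall>u\<in>W. (\<Sum>v\<in>W. a u v * x v) = 0) \<longrightarrow> (\<forall>v\<in>W. x v = 0))"

text \<open>The entries of A - c I. At \<open>c = - 1\<close> this is the matrix \<open>N\<close> of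
  the overview; at \<open>c = 0\<close> it is A itself.\<close>

definition shifted :: "real \<Rightarrow> ('a \<Rightarrow> 'a \<Rightarrow> real) \<Rightarrow> 'a \<Rightarrow> 'a \<Rightarrow> real" where
  "shifted c a u v = a u v - (if u = v then c else 0)"

locale symmetric_form =
  fixes V :: "'a set" and a :: "'a \<Rightarrow> 'a \<Rightarrow> real"
  assumes finite_V: "finite V" and sym: "u \<in> V \<Longrightarrow> v \<in> V \<Longrightarrow> a u v = a v u"
begin

definition spec :: "real multiset" where "spec = proots (char_poly (vertex_matrix V a))"

text \<open>A = P D Q with Q inverse to P, transported from numbers to vertices: the columns of
  \<open>p\<close> are eigenvectors and the rows of \<open>q\<close> form the dual basis.\<close>

lemma spectral_decomposition:
  obtains e :: "nat \<Rightarrow> real" and p :: "'a \<Rightarrow> nat \<Rightarrow> real" and q :: "nat \<Rightarrow> 'a \<Rightarrow> real" where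
    "\<And>i j. i < card V \<Longrightarrow> j < card V \<Longrightarrow> (\<Sum>v\<in>V. q i v * p v j) = (if i = j then 1 else 0)"
    "\<And>u v. u \<in> V \<Longrightarrow> v \<in> V \<Longrightarrow> (\<Sum>i<card V. p u i * q i v) = (if u = v then 1 else 0)"
    "\<And>u v. u \<in> V \<Longrightarrow> v \<in> V \<Longrightarrow> a u v = (\<Sum>i<card V. p u i * e i * q i v)"
    "spec = image_mset e (mset_set {..<card V})"
proof -
  define n where "n = card V"
  let ?f = "from_nat_into V" and ?A = "vertex_matrix V a"
  define g where "g = the_inv_into {..<n} ?f"
  have f: "bij_betw ?f {..<n} V" unfolding n_def by (rule bij_betw_from_nat_into_finite[OF finite_V])
  have gf: "g (?f i) = i" if "i < n" for i
    using that f unfolding g_def by (intro the_inv_into_f_f) (auto simp: bij_betw_def)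
  have fg: "?f (g v) = v" if "v \<in> V" for v
    using that f unfolding g_def by (intro f_the_inv_into_f) (auto simp: bij_betw_def)
  have g: "g v < n" if "v \<in> V" for v
    using that f the_inv_into_into[of ?f "{..<n}" v "{..<n}"] unfolding g_def by (auto simp: bij_betw_def)
  have A: "?A \<in> carrier_mat n n" by (simp add: vertex_matrix_def n_def)
  have fV: "?f i \<in> V" if "i < n" for i using f that by (auto simp: bij_betw_def)
  obtain es P Q where D: "length es = n" "P \<in> carrier_mat n n" "Q \<in> carrier_mat n n"
    "P * Q = 1\<^sub>m n" "Q * P = 1\<^sub>m n" and cp: "char_poly ?A = (\<Prod>e\<leftarrow>es. [:- e, 1:])"
    and dec: "?A = P * mat n n (\<lambda>(i, j). if i = j then es ! i else 0) * Q"
    by (rule symmetric_diagonalizable[OF A]) (auto simp: vertex_matrix_def n_def[symmetric] fV sym)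
  let ?p = "\<lambda>v i. P $$ (g v, i)" and ?q = "\<lambda>i v. Q $$ (i, g v)"
  have prod: "(X * Y) $$ (i, j) = (\<Sum>k<n. X $$ (i, k) * Y $$ (k, j))"
    if "X \<in> carrier_mat n n" "Y \<in> carrier_mat n n" "i < n" "j < n" for X Y :: "real mat" and i j
    using that by (simp add: scalar_prod_def lessThan_atLeast0)
  show ?thesis
  proof (rule that[of ?q ?p "(!) es", folded n_def])
    fix i j assume "i < n" "j < n"
    have "(\<Sum>v\<in>V. ?q i v * ?p v j) = (\<Sum>k<n. Q $$ (i, k) * P $$ (k, j))"
      by (rule sum.reindex_bij_betw[OF f, symmetric, THEN trans]) (auto simp: gf)
    thus "(\<Sum>v\<in>V. ?q i v * ?p v j) = (if i = j then 1 else 0)"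
      using prod[OF D(3,2) \<open>i < n\<close> \<open>j < n\<close>] \<open>i < n\<close> \<open>j < n\<close> by (simp add: D(5))
  next
    fix u v assume "u \<in> V" "v \<in> V"
    hence uv: "g u < n" "g v < n" "g u = g v \<longleftrightarrow> u = v" using g fg by metis+
    show "(\<Sum>i<n. ?p u i * ?q i v) = (if u = v then 1 else 0)"
      using prod[OF D(2,3) uv(1,2)] uv by (simp add: D(4))
    have "a u v = ?A $$ (g u, g v)"
      using uv fg \<open>u \<in> V\<close> \<open>v \<in> V\<close> by (simp add: vertex_matrix_def n_def[symmetric])
    also have "\<dots> = (\<Sum>k<n. (\<Sum>l<n. P $$ (g u, l) * (if l = k then es ! l else 0)) * Q $$ (k, g v))"
      unfolding dec using D(2,3) uv
      by (subst prod[of _ Q]) (auto simp: prod[of P] simp del: index_mult_mat(1) intro!: sum.cong)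
    finally show "a u v = (\<Sum>i<n. ?p u i * es ! i * ?q i v)" by (simp add: if_distrib cong: if_cong)
  next
    have "(\<Sum>p\<leftarrow>map (\<lambda>e. [:- e, 1:]) es. proots p) = mset es" by (induction es) auto
    hence "spec = mset es"
      unfolding spec_def cp using proots_prod_list[of "map (\<lambda>e. [:- e, 1:]) es"]
      by (auto simp: image_iff)
    thus "spec = image_mset ((!) es) (mset_set {..<n})"
      by (metis D(1) atLeast_upt map_nth mset_map mset_upt lessThan_atLeast0)
  qed
qed

lemma size_spec: "size spec = card V"
  by (rule spectral_decomposition) simp

lemma shifted_decomposition:
  assumes "\<And>u v. u \<in> V \<Longrightarrow> v \<in> V \<Longrightarrow> (\<Sum>i<card V. p u i * q i v) = (if u = v then 1 else 0)"
    and "\<And>u v. u \<in> V \<Longrightarrow> v \<in> V \<Longrightarrow> a u v = (\<Sum>i<card V. p u i * e i * q i v)"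
    and uv: "u \<in> V" "v \<in> V"
  shows "shifted c a u v = (\<Sum>i<card V. p u i * (e i - c) * q i v)"
proof -
  have "(\<Sum>i<card V. p u i * (e i - c) * q i v)
      = (\<Sum>i<card V. p u i * e i * q i v) - c * (\<Sum>i<card V. p u i * q i v)"
    unfolding sum_distrib_left sum_subtractf[symmetric] by (intro sum.cong) (auto simp: algebra_simps)
  thus ?thesis using assms(1)[OF uv] assms(2)[OF uv] by (simp add: shifted_def)
qed

text \<open>A - c I factors through the eigenvalue positions \<open>?Z\<close> with
  \<open>e i \<noteq> c\<close>. If \<open>W\<close> had more elements than \<open>?Z\<close>, a
  nonzero vector supported on \<open>W\<close> would be killed by all \<open>q i\<close> with i in
  \<open>?Z\<close>, hence by the submatrix.\<close>

lemma nonsingular_on_imp_count: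
  assumes W: "W \<subseteq> V" and ns: "nonsingular_on W (shifted c a)"
  shows "count spec c + card W \<le> card V"
proof -
  obtain e p q where pq: "\<And>u v. u \<in> V \<Longrightarrow> v \<in> V \<Longrightarrow> (\<Sum>i<card V. p u i * q i v) = (if u = v then 1 else 0)"
    and dec: "\<And>u v. u \<in> V \<Longrightarrow> v \<in> V \<Longrightarrow> a u v = (\<Sum>i<card V. p u i * e i * q i v)"
    and spec: "spec = image_mset e (mset_set {..<card V})"
    by (rule spectral_decomposition) blast
  let ?Z = "{i. i < card V \<and> e i \<noteq> c}" and ?C = "{i. i < card V \<and> e i = c}"
  have "count spec c = card ?C"
    unfolding spec by (simp add: count_image_mset' count_mset_set' sum.If_cases)
      (auto intro: arg_cong[of _ _ card])
  moreover have "card ?C + card ?Z = card V"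
    by (subst card_Un_disjoint[symmetric]) (auto intro: arg_cong[of _ _ card, of _ "{..<card V}", simplified])
  moreover have "card W \<le> card ?Z"
  proof (rule ccontr)
    assume "\<not> card W \<le> card ?Z"
    hence "card ?Z < card W" by simp
    from underdetermined_system[OF _ finite_subset[OF W finite_V] this, of q]
    obtain x where x: "\<exists>v\<in>W. x v \<noteq> 0" and eq: "\<And>i. i \<in> ?Z \<Longrightarrow> (\<Sum>v\<in>W. q i v * x v) = 0"
      by auto
    have "(\<Sum>v\<in>W. shifted c a u v * x v) = 0" if "u \<in> W" for u
    proof -
      have "shifted c a u v = (\<Sum>i<card V. p u i * (e i - c) * q i v)" if "v \<in> W" for v
        using W \<open>u \<in> W\<close> that by (intro shifted_decomposition[OF pq dec]) auto
      hence "(\<Sum>v\<in>W. shifted c a u v * x v) = (\<Sum>v\<in>W. \<Sum>i<card V. p u i * (e i - c) * (q i v * x v))"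
        by (simp add: sum_distrib_right mult.assoc)
      also have "\<dots> = (\<Sum>i<card V. p u i * (e i - c) * (\<Sum>v\<in>W. q i v * x v))"
        unfolding sum_distrib_left by (rule sum.swap)
      also have "\<dots> = 0" using eq by (intro sum.neutral) auto
      finally show ?thesis .
    qed
    thus False using ns x unfolding nonsingular_on_def by blast
  qed
  ultimately show ?thesis by linarith
qed

text \<open>If there were more eigenvalues different from \<open>c\<close> than rows in
  \<open>T\<close>, some nonzero combination of their eigenvectors would satisfy the equations of
  \<open>T\<close>, hence all equations. But A - c I is injective on the span of these
  eigenvectors.\<close>

lemma determining_rows_imp_count:
  assumes T: "T \<subseteq> V"
    and det: "\<And>x. (\<And>u. u \<in> T \<Longrightarrow> (\<Sum>v\<in>V. shifted c a u v * x v) = 0)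
      \<Longrightarrow> (\<And>u. u \<in> V \<Longrightarrow> (\<Sum>v\<in>V. shifted c a u v * x v) = 0)"
  shows "card V \<le> count spec c + card T"
proof -
  obtain e p q where qp: "\<And>i j. i < card V \<Longrightarrow> j < card V \<Longrightarrow> (\<Sum>v\<in>V. q i v * p v j) = (if i = j then 1 else 0)"
    and dec: "\<And>u v. u \<in> V \<Longrightarrow> v \<in> V \<Longrightarrow> a u v = (\<Sum>i<card V. p u i * e i * q i v)"
    and spec: "spec = image_mset e (mset_set {..<card V})"
    by (rule spectral_decomposition) blast
  let ?Z = "{i. i < card V \<and> e i \<noteq> c}" and ?C = "{i. i < card V \<and> e i = c}"
  have "count spec c = card ?C"
    unfolding spec by (simp add: count_image_mset' count_mset_set' sum.If_cases)
      (auto intro: arg_cong[of _ _ card])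
  moreover have "card ?C + card ?Z = card V"
    by (subst card_Un_disjoint[symmetric]) (auto intro: arg_cong[of _ _ card, of _ "{..<card V}", simplified])
  moreover have "card ?Z \<le> card T"
  proof (rule ccontr)
    assume "\<not> card ?Z \<le> card T"
    hence "card T < card ?Z" by simp
    from underdetermined_system[OF finite_subset[OF T finite_V] _ this, of "\<lambda>u i. p u i * (e i - c)"]
    obtain y where y: "\<exists>i\<in>?Z. y i \<noteq> 0"
      and eq: "\<And>u. u \<in> T \<Longrightarrow> (\<Sum>i\<in>?Z. p u i * (e i - c) * y i) = 0"
      by auto
    define x where "x v = (\<Sum>i\<in>?Z. p v i * y i)" for v
    have ap: "(\<Sum>v\<in>V. shifted c a u v * p v i) = p u i * (e i - c)" if "u \<in> V" "i < card V" for u i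
    proof -
      have "(\<Sum>v\<in>V. a u v * p v i) = (\<Sum>v\<in>V. \<Sum>j<card V. p u j * e j * (q j v * p v i))"
        using that by (simp add: dec sum_distrib_right mult.assoc)
      also have "\<dots> = (\<Sum>j<card V. p u j * e j * (\<Sum>v\<in>V. q j v * p v i))"
        unfolding sum_distrib_left by (rule sum.swap)
      also have "\<dots> = (\<Sum>j<card V. if j = i then p u j * e j else 0)"
        using that by (intro sum.cong) (auto simp: qp)
      also have "\<dots> = p u i * e i" using that by simp
      finally have "(\<Sum>v\<in>V. a u v * p v i) = p u i * e i" .
      moreover have "(\<Sum>v\<in>V. (if u = v then c else 0) * p v i) = c * p u i"
        using that finite_V by (simp add: if_distrib[of "\<lambda>z. z * _"] cong: if_cong)
      ultimately show ?thesis by (simp add: shifted_def left_diff_distrib sum_subtractf algebra_simps)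
    qed
    have Nx: "(\<Sum>v\<in>V. shifted c a u v * x v) = (\<Sum>i\<in>?Z. p u i * (e i - c) * y i)" if "u \<in> V" for u
    proof -
      have "(\<Sum>v\<in>V. shifted c a u v * x v) = (\<Sum>v\<in>V. \<Sum>i\<in>?Z. shifted c a u v * p v i * y i)"
        unfolding x_def by (simp add: sum_distrib_left mult.assoc)
      also have "\<dots> = (\<Sum>i\<in>?Z. (\<Sum>v\<in>V. shifted c a u v * p v i) * y i)"
        unfolding sum_distrib_right by (rule sum.swap)
      finally show ?thesis using that by (simp add: ap)
    qed
    have "(\<Sum>i\<in>?Z. p u i * (e i - c) * y i) = 0" if "u \<in> V" for u
    proof -
      have "(\<Sum>v\<in>V. shifted c a u v * x v) = 0"
      proof (rule det[OF _ that])
        fix w assume "w \<in> T"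
        moreover from this have "w \<in> V" using T by blast
        ultimately show "(\<Sum>v\<in>V. shifted c a w v * x v) = 0" using Nx eq by simp
      qed
      thus ?thesis using Nx that by simp
    qed
    \<comment> \<open>Pairing with the dual vector \<open>q j\<close> extracts the coefficient
      \<open>(e j - c) * y j\<close>, whose first factor is nonzero.\<close>
    hence "(\<Sum>u\<in>V. q j u * (\<Sum>i\<in>?Z. p u i * (e i - c) * y i)) = 0" for j
      by simp
    moreover have "(\<Sum>u\<in>V. q j u * (\<Sum>i\<in>?Z. p u i * (e i - c) * y i)) = (e j - c) * y j" if "j \<in> ?Z" for j
    proof -
      have "(\<Sum>u\<in>V. q j u * (\<Sum>i\<in>?Z. p u i * (e i - c) * y i))
          = (\<Sum>u\<in>V. \<Sum>i\<in>?Z. q j u * p u i * ((e i - c) * y i))"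
        by (simp add: sum_distrib_left mult.assoc)
      also have "\<dots> = (\<Sum>i\<in>?Z. (\<Sum>u\<in>V. q j u * p u i) * ((e i - c) * y i))"
        unfolding sum_distrib_right by (rule sum.swap)
      also have "\<dots> = (\<Sum>i\<in>?Z. if i = j then (e j - c) * y j else 0)"
        using that by (intro sum.cong) (auto simp: qp)
      finally show ?thesis using that by simp
    qed
    ultimately have "y j = 0" if "j \<in> ?Z" for j using that by force
    thus False using y by blast
  qed
  ultimately show ?thesis by linarith
qed

text \<open>By symmetry a kernel vector \<open>x\<close> is also a linear relation between the rows.
  If \<open>x w\<close> is nonzero, the row of \<open>w\<close> is a combination of the others, so
  \<open>V - {w}\<close> is a determining set of rows.\<close>

lemma spec_iff_singular: "c \<in># spec \<longleftrightarrow> \<not> nonsingular_on V (shifted c a)"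
proof
  assume "c \<in># spec"
  thus "\<not> nonsingular_on V (shifted c a)"
    using nonsingular_on_imp_count[of V c] count_greater_zero_iff[of spec c] by fastforce
next
  assume "\<not> nonsingular_on V (shifted c a)"
  then obtain x w where x: "\<And>u. u \<in> V \<Longrightarrow> (\<Sum>v\<in>V. shifted c a u v * x v) = 0"
    and w: "w \<in> V" "x w \<noteq> 0"
    unfolding nonsingular_on_def by blast
  have sym': "shifted c a u v = shifted c a v u" if "u \<in> V" "v \<in> V" for u v
    using sym[OF that] by (simp add: shifted_def)
  have "card V \<le> count spec c + card (V - {w})"
  proof (rule determining_rows_imp_count)
    fix y u assume T: "\<And>u. u \<in> V - {w} \<Longrightarrow> (\<Sum>v\<in>V. shifted c a u v * y v) = 0" and u: "u \<in> V"
    have "(\<Sum>u\<in>V. x u * (\<Sum>v\<in>V. shifted c a u v * y v)) = (\<Sum>u\<in>V. \<Sum>v\<in>V. shifted c a v u * x u * y v)"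
      using sym' by (simp add: sum_distrib_left mult_ac)
    also have "\<dots> = (\<Sum>v\<in>V. (\<Sum>u\<in>V. shifted c a v u * x u) * y v)"
      unfolding sum_distrib_right by (rule sum.swap)
    also have "\<dots> = 0" using x by simp
    finally have "(\<Sum>u\<in>V. x u * (\<Sum>v\<in>V. shifted c a u v * y v)) = 0" .
    moreover have "(\<Sum>u\<in>V. x u * (\<Sum>v\<in>V. shifted c a u v * y v)) = x w * (\<Sum>v\<in>V. shifted c a w v * y v)"
      using w finite_V T by (simp add: sum.remove[of V w])
    ultimately show "(\<Sum>v\<in>V. shifted c a u v * y v) = 0" using T[of u] u w by (cases "u = w") auto
  qed auto
  moreover have "card (V - {w}) < card V" by (rule card_Diff1_less[OF finite_V w(1)])
  ultimately have "0 < count spec c" by linarith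
  thus "c \<in># spec" by simp
qed

text \<open>The traces of the square and the cube of A - c I, written out in entries; these are the
  spectral invariants that can be computed from the graph.\<close>

lemma spec_power_sums:
  fixes c :: real
  defines "b \<equiv> shifted c a"
  shows "(\<Sum>x\<in>#spec. (x - c)\<^sup>2) = (\<Sum>u\<in>V. \<Sum>v\<in>V. b u v * b v u)"
    and "(\<Sum>x\<in>#spec. (x - c) ^ 3) = (\<Sum>u\<in>V. \<Sum>v\<in>V. \<Sum>w\<in>V. b u v * b v w * b w u)"
proof -
  obtain e' p q where qp: "\<And>i j. i < card V \<Longrightarrow> j < card V \<Longrightarrow> (\<Sum>v\<in>V. q i v * p v j) = (if i = j then 1 else 0)"
    and pq: "\<And>u v. u \<in> V \<Longrightarrow> v \<in> V \<Longrightarrow> (\<Sum>i<card V. p u i * q i v) = (if u = v then 1 else 0)"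
    and dec': "\<And>u v. u \<in> V \<Longrightarrow> v \<in> V \<Longrightarrow> a u v = (\<Sum>i<card V. p u i * e' i * q i v)"
    and spec: "spec = image_mset e' (mset_set {..<card V})"
    by (rule spectral_decomposition) blast
  define e where "e i = e' i - c" for i
  have dec: "b u v = (\<Sum>i<card V. p u i * e i * q i v)" if "u \<in> V" "v \<in> V" for u v
    unfolding e_def b_def by (rule shifted_decomposition[of p q e']) (use pq dec' that in auto)
  \<comment> \<open>Multiplying P diag(f) Q by P diag(e) Q multiplies the diagonals, because Q P is
    the identity.\<close>
  have step: "(\<Sum>v\<in>V. (\<Sum>i<card V. p u i * f i * q i v) * b v w) = (\<Sum>i<card V. p u i * (f i * e i) * q i w)"
    if "u \<in> V" "w \<in> V" for f u w
  proof -
    have "(\<Sum>v\<in>V. (\<Sum>i<card V. p u i * f i * q i v) * b v w)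
      = (\<Sum>v\<in>V. \<Sum>i<card V. \<Sum>j<card V. p u i * f i * (q i v * p v j) * (e j * q j w))"
      by (intro sum.cong refl, simp add: that dec sum_product, intro sum.cong refl, simp)
    also have "\<dots> = (\<Sum>i<card V. \<Sum>v\<in>V. \<Sum>j<card V. p u i * f i * (q i v * p v j) * (e j * q j w))"
      by (rule sum.swap)
    also have "\<dots> = (\<Sum>i<card V. \<Sum>j<card V. \<Sum>v\<in>V. p u i * f i * (q i v * p v j) * (e j * q j w))"
      by (intro sum.cong refl sum.swap)
    also have "\<dots> = (\<Sum>i<card V. \<Sum>j<card V. p u i * f i * (\<Sum>v\<in>V. q i v * p v j) * (e j * q j w))"
      by (simp add: sum_distrib_left sum_distrib_right)
    also have "\<dots> = (\<Sum>i<card V. \<Sum>j<card V. if i = j then p u i * (f i * e i) * q i w else 0)"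
      by (intro sum.cong refl) (auto simp: qp)
    finally show ?thesis by simp
  qed
  have trace: "(\<Sum>u\<in>V. \<Sum>i<card V. p u i * f i * q i u) = (\<Sum>i<card V. f i)" for f
  proof -
    have "(\<Sum>u\<in>V. \<Sum>i<card V. p u i * f i * q i u) = (\<Sum>i<card V. \<Sum>u\<in>V. p u i * f i * q i u)"
      by (rule sum.swap)
    also have "\<dots> = (\<Sum>i<card V. f i * (\<Sum>u\<in>V. q i u * p u i))"
      by (simp add: sum_distrib_left mult_ac)
    finally show ?thesis by (simp add: qp)
  qed
  have sums: "(\<Sum>x\<in>#spec. f (x - c)) = (\<Sum>i<card V. f (e i))" for f :: "real \<Rightarrow> real"
    unfolding spec e_def by (simp add: sum_unfold_sum_mset image_mset.compositionality o_def)
  have two: "(\<Sum>v\<in>V. b u v * b v w) = (\<Sum>i<card V. p u i * (e i * e i) * q i w)" if "u \<in> V" "w \<in> V" for u w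
    using step[OF that, of e] that by (simp add: dec)
  show "(\<Sum>x\<in>#spec. (x - c)\<^sup>2) = (\<Sum>u\<in>V. \<Sum>v\<in>V. b u v * b v u)"
    using trace[of "\<lambda>i. e i * e i"] sums[of "\<lambda>x. x\<^sup>2"] by (simp add: two power2_eq_square)
  have "(\<Sum>v\<in>V. \<Sum>w\<in>V. b u v * b v w * b w u) = (\<Sum>i<card V. p u i * (e i * e i * e i) * q i u)" if "u \<in> V" for u
  proof -
    have "(\<Sum>v\<in>V. \<Sum>w\<in>V. b u v * b v w * b w u) = (\<Sum>w\<in>V. (\<Sum>v\<in>V. b u v * b v w) * b w u)"
      unfolding sum_distrib_right by (rule sum.swap)
    also have "\<dots> = (\<Sum>w\<in>V. (\<Sum>i<card V. p u i * (e i * e i) * q i w) * b w u)"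
      using that by (simp add: two)
    also have "\<dots> = (\<Sum>i<card V. p u i * (e i * e i * e i) * q i u)" by (rule step[OF that that])
    finally show ?thesis .
  qed
  thus "(\<Sum>x\<in>#spec. (x - c) ^ 3) = (\<Sum>u\<in>V. \<Sum>v\<in>V. \<Sum>w\<in>V. b u v * b v w * b w u)"
    using trace[of "\<lambda>i. e i * e i * e i"] sums[of "\<lambda>x. x ^ 3"] by (simp add: power3_eq_cube)
qed

end

section \<open>Distances and eccentricities\<close>

text \<open>A \<open>digraph_iso\<close> carries an arc map and new tail and head functions besides
  the vertex map. When arcs are pairs, all of these are forced by the vertex map.\<close>

lemma graph_iso_iff:
  fixes G :: "'a pair_pre_digraph" and H :: "'b pair_pre_digraph"
  assumes G: "pair_wf_digraph G" and H: "pair_wf_digraph H"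
  shows "G \<cong>\<^sub>g H \<longleftrightarrow> (\<exists>f. bij_betw f (pverts G) (pverts H) \<and>
    (\<forall>u\<in>pverts G. \<forall>v\<in>pverts G. (u, v) \<in> parcs G \<longleftrightarrow> (f u, f v) \<in> parcs H))"
    (is "_ \<longleftrightarrow> (\<exists>f. ?iso f)")
proof
  assume "G \<cong>\<^sub>g H"
  then obtain h where h: "pre_digraph.digraph_isomorphism (with_proj G) h"
    and eq: "with_proj H = app_iso h (with_proj G)"
    unfolding digraph_iso_def by blast
  let ?f = "iso_verts h"
  have inj: "inj_on ?f (pverts G)"
    using h by (simp add: pre_digraph.digraph_isomorphism_def)
  have V: "pverts H = ?f ` pverts G" using arg_cong[OF eq, of verts] by simp
  have E: "parcs H = iso_arcs h ` parcs G" using arg_cong[OF eq, of arcs] by simp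
  have th: "iso_tail h = fst" "iso_head h = snd"
    using arg_cong[OF eq, of tail] arg_cong[OF eq, of head] by simp_all
  have hE: "iso_arcs h a = (?f (fst a), ?f (snd a))" if "a \<in> parcs G" for a
    using h that th by (simp add: pre_digraph.digraph_isomorphism_def prod_eq_iff)
  have "(u, v) \<in> parcs G \<longleftrightarrow> (?f u, ?f v) \<in> parcs H" if uv: "u \<in> pverts G" "v \<in> pverts G" for u v
  proof
    assume "(u, v) \<in> parcs G"
    thus "(?f u, ?f v) \<in> parcs H" using hE[of "(u, v)"] E by force
  next
    assume "(?f u, ?f v) \<in> parcs H"
    then obtain a where a: "a \<in> parcs G" "(?f u, ?f v) = (?f (fst a), ?f (snd a))"
      using E hE by auto
    have "fst a = u" "snd a = v"
      using a inj uv pair_wf_digraph.arc_fst_in_verts[OF G a(1)] pair_wf_digraph.arc_snd_in_verts[OF G a(1)]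
      by (auto dest: inj_onD)
    thus "(u, v) \<in> parcs G" using a(1) by (metis prod.collapse)
  qed
  hence "?iso ?f" using inj V unfolding bij_betw_def by blast
  thus "\<exists>f. ?iso f" by blast
next
  assume "\<exists>f. ?iso f"
  then obtain f where f: "bij_betw f (pverts G) (pverts H)"
    and arcs: "\<And>u v. u \<in> pverts G \<Longrightarrow> v \<in> pverts G \<Longrightarrow> (u, v) \<in> parcs G \<longleftrightarrow> (f u, f v) \<in> parcs H"
    by blast
  note GV = pair_wf_digraph.in_arcsD1[OF G] pair_wf_digraph.in_arcsD2[OF G]
  note HV = pair_wf_digraph.in_arcsD1[OF H] pair_wf_digraph.in_arcsD2[OF H]
  define h :: "('a, 'a \<times> 'a, 'b, 'b \<times> 'b) digraph_isomorphism" where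
    "h = \<lparr>iso_verts = f, iso_arcs = map_prod f f, iso_head = snd, iso_tail = fst\<rparr>"
  interpret G: pair_wf_digraph G by (rule G)
  have "wf_digraph (with_proj G)" by unfold_locales
  moreover have "inj_on (map_prod f f) (parcs G)"
    using f GV unfolding bij_betw_def inj_on_def by (auto; blast)
  ultimately have "pre_digraph.digraph_isomorphism (with_proj G) h"
    using f by (auto simp: h_def pre_digraph.digraph_isomorphism_def bij_betw_def)
  moreover have "parcs H = map_prod f f ` parcs G"
  proof (intro equalityI subsetI)
    fix e assume e: "e \<in> parcs H"
    then obtain u v where uv: "e = (f u, f v)" "u \<in> pverts G" "v \<in> pverts G"
      using HV f unfolding bij_betw_def by (cases e) blast
    hence "(u, v) \<in> parcs G" using arcs e by blast
    thus "e \<in> map_prod f f ` parcs G" unfolding uv(1) by force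
  next
    fix e assume "e \<in> map_prod f f ` parcs G"
    then obtain u v where uv: "(u, v) \<in> parcs G" "e = (f u, f v)" by auto
    thus "e \<in> parcs H" using arcs[OF GV[OF uv(1)]] by blast
  qed
  hence "with_proj H = app_iso h (with_proj G)"
    using f by (auto simp: with_proj_def app_iso_def h_def bij_betw_def)
  ultimately show "G \<cong>\<^sub>g H" unfolding digraph_iso_def by blast
qed

section \<open>Distances as natural numbers\<close>

locale finite_connected_graph =
  fixes G :: "'a pair_pre_digraph"
  assumes connected: "connected_graph G"
begin

abbreviation V where "V \<equiv> pverts G"
abbreviation adj where "adj u v \<equiv> (u, v) \<in> parcs G"

sublocale pair_graph G using connected by simp

lemma adj_sym: "adj u v \<longleftrightarrow> adj v u"
  using pair_sym_arcs unfolding symmetric_def by (auto dest: symD)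

lemma adj_irrefl: "\<not> adj u u"
  using pair_no_loops[of "(u, u)"] by auto

lemma adj_in_V: "adj u v \<Longrightarrow> u \<in> V" "adj u v \<Longrightarrow> v \<in> V"
  by (auto dest: in_arcsD1 in_arcsD2)

lemma awalk_iff_relpow:
  assumes "u \<in> V"
  shows "(\<exists>p. awalk u p v \<and> length p = k) \<longleftrightarrow> (u, v) \<in> parcs G ^^ k"
  using assms
proof (induction k arbitrary: u)
  case 0
  thus ?case by (auto simp: awalk_def)
next
  case (Suc k)
  have "(\<exists>p. awalk u p v \<and> length p = Suc k) \<longleftrightarrow>
    (\<exists>w p. adj u w \<and> awalk w p v \<and> length p = k)"
  proof safe
    fix p assume "awalk u p v" "length p = Suc k"
    thus "\<exists>w p. adj u w \<and> awalk w p v \<and> length p = k"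
      by (cases p) (auto simp: awalk_Cons_iff, blast)
  next
    fix w p assume "adj u w" "awalk w p v" "k = length p"
    thus "\<exists>pa. awalk u pa v \<and> length pa = Suc (length p)"
      by (intro exI[of _ "(u, w) # p"]) (auto simp: awalk_Cons_iff)
  qed
  also have "\<dots> \<longleftrightarrow> (\<exists>w. adj u w \<and> (w, v) \<in> parcs G ^^ k)"
    using Suc.IH adj_in_V by blast
  also have "\<dots> \<longleftrightarrow> (u, v) \<in> parcs G ^^ Suc k"
    by (metis relpow_Suc_D2 relpow_Suc_I2)
  finally show ?case .
qed

text \<open>The working form of \<open>graph_dist\<close>; connectedness makes the least exponent
  exist.\<close>

definition hops :: "'a \<Rightarrow> 'a \<Rightarrow> nat" where
  "hops u v = (LEAST k. (u, v) \<in> parcs G ^^ k)"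

lemma relpow_hops:
  assumes "u \<in> V" "v \<in> V"
  shows "(u, v) \<in> parcs G ^^ hops u v"
proof -
  have "strongly_connected G"
    using symmetric_connected_imp_strongly_connected[OF pair_sym_arcs] connected by blast
  hence "u \<rightarrow>\<^sup>*\<^bsub>with_proj G\<^esub> v" using assms by (simp add: strongly_connected_def)
  hence "\<exists>k. (u, v) \<in> parcs G ^^ k"
    using awalk_iff_relpow[OF assms(1)] by (auto simp: reachable_awalk)
  thus ?thesis unfolding hops_def by (rule LeastI_ex)
qed

lemma hops_le: "(u, v) \<in> parcs G ^^ k \<Longrightarrow> hops u v \<le> k"
  unfolding hops_def by (rule Least_le)

lemma graph_dist_eq_hops:
  assumes "u \<in> V" "v \<in> V"
  shows "graph_dist G u v = real (hops u v)"
proof -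
  have cost: "awalk_cost (\<lambda>_. 1) p = real (length p)" for p :: "('a \<times> 'a) list"
    by (induction p) auto
  have "\<mu> (\<lambda>_. 1) u v = ereal (real (hops u v))"
  proof (rule antisym)
    obtain p where "awalk u p v" "length p = hops u v"
      using relpow_hops[OF assms] awalk_iff_relpow[OF assms(1)] by blast
    thus "\<mu> (\<lambda>_. 1) u v \<le> ereal (real (hops u v))"
      using min_cost_le_walk_cost[of u p v "\<lambda>_. 1"] by (simp add: cost)
    show "ereal (real (hops u v)) \<le> \<mu> (\<lambda>_. 1) u v"
      unfolding \<mu>_def
    proof (rule INF_greatest)
      fix p assume "p \<in> {p. awalk u p v}"
      hence "hops u v \<le> length p" using hops_le awalk_iff_relpow[OF assms(1)] by blast
      thus "ereal (real (hops u v)) \<le> ereal (awalk_cost (\<lambda>_. 1) p)" by (simp add: cost)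
    qed
  qed
  thus ?thesis by (simp add: graph_dist_def)
qed

lemma hops_triangle:
  assumes "u \<in> V" "v \<in> V" "w \<in> V"
  shows "hops u w \<le> hops u v + hops v w"
proof -
  have "(u, w) \<in> parcs G ^^ (hops u v + hops v w)"
    unfolding relpow_add using relpow_hops assms by (blast intro: relcompI)
  thus ?thesis by (rule hops_le)
qed

lemma hops_sym:
  assumes "u \<in> V" "v \<in> V"
  shows "hops u v = hops v u"
proof -
  have "(v, u) \<in> parcs G ^^ k" if "(u, v) \<in> parcs G ^^ k" for u v k
    using that
  proof (induction k arbitrary: v)
    case (Suc k)
    then obtain w where "(u, w) \<in> parcs G ^^ k" "adj w v" by auto
    thus ?case using Suc.IH adj_sym by (metis relpow_Suc_I2)
  qed simp
  hence "(u, v) \<in> parcs G ^^ k \<longleftrightarrow> (v, u) \<in> parcs G ^^ k" for k by blast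
  thus ?thesis unfolding hops_def by simp
qed

lemma hops_0_iff: "u \<in> V \<Longrightarrow> v \<in> V \<Longrightarrow> hops u v = 0 \<longleftrightarrow> u = v"
  using relpow_hops[of u v] hops_le[of u v 0] by auto

lemma hops_1_iff:
  assumes uv: "u \<in> V" "v \<in> V"
  shows "hops u v = 1 \<longleftrightarrow> adj u v"
proof
  show "hops u v = 1" if "adj u v"
  proof -
    have "hops u v \<le> 1" using hops_le[of u v 1] that by simp
    moreover have "hops u v \<noteq> 0" using hops_0_iff[OF uv] that adj_irrefl by auto
    ultimately show ?thesis by simp
  qed
  show "adj u v" if "hops u v = 1" using relpow_hops[OF uv] that by simp
qed

lemma geodesic:
  assumes "u \<in> V" "v \<in> V"
  obtains p where "\<And>i. i \<le> hops u v \<Longrightarrow> p i \<in> V" "p 0 = u" "p (hops u v) = v"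
    "\<And>i j. i \<le> j \<Longrightarrow> j \<le> hops u v \<Longrightarrow> hops (p i) (p j) = j - i"
proof -
  let ?d = "hops u v"
  obtain p where p: "p 0 = u" "p ?d = v" and step: "\<And>i. i < ?d \<Longrightarrow> adj (p i) (p (Suc i))"
    using relpow_hops[OF assms] unfolding relpow_fun_conv by blast
  have pV: "p i \<in> V" if "i \<le> ?d" for i
    using that step[of i] p assms adj_in_V by (cases "i = ?d") auto
  have "(p i, p (i + k)) \<in> parcs G ^^ k" if "i + k \<le> ?d" for i k
    using that
  proof (induction k)
    case (Suc k)
    thus ?case using step[of "i + k"] by (auto intro: relcompI)
  qed simp
  hence le: "hops (p i) (p j) \<le> j - i" if "i \<le> j" "j \<le> ?d" for i j
    using hops_le that by (metis le_add_diff_inverse)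
  have "hops (p i) (p j) = j - i" if ij: "i \<le> j" "j \<le> ?d" for i j
  proof -
    \<comment> \<open>A shortcut between \<open>p i\<close> and \<open>p j\<close> would yield a
      walk from \<open>u\<close> to \<open>v\<close> shorter than the distance.\<close>
    have "?d \<le> hops u (p i) + (hops (p i) (p j) + hops (p j) v)"
      using hops_triangle[of u "p i" v] hops_triangle[of "p i" "p j" v] pV[of i] pV[of j] ij assms
      by linarith
    also have "\<dots> \<le> i + (hops (p i) (p j) + (?d - j))"
      using le[of 0 i] le[of j ?d] ij p by (intro add_mono) auto
    finally show ?thesis using le[OF ij] ij by linarith
  qed
  thus ?thesis using that pV p by blast
qed

definition ecc :: "'a \<Rightarrow> nat" where "ecc v = Max ((\<lambda>u. hops u v) ` V)"

lemma hops_le_ecc: "u \<in> V \<Longrightarrow> hops u v \<le> ecc v"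
  unfolding ecc_def using pair_finite_verts by (intro Max_ge) auto

lemma ecc_attained:
  assumes "v \<in> V"
  obtains u where "u \<in> V" "hops u v = ecc v"
proof -
  have "ecc v \<in> (\<lambda>u. hops u v) ` V"
    unfolding ecc_def using pair_finite_verts assms by (intro Max_in) auto
  thus ?thesis using that by auto
qed

lemma eccentricity_eq_ecc: "v \<in> V \<Longrightarrow> eccentricity G v = real (ecc v)"
  unfolding eccentricity_def ecc_def using pair_finite_verts
  by (subst mono_Max_commute[of real]) (auto simp: mono_def image_image graph_dist_eq_hops
    intro!: arg_cong[of _ _ Max] image_cong)

lemma ecc_entry_eq:
  assumes "u \<in> V" "v \<in> V"
  shows "ecc_entry G u v = (if hops u v = min (ecc u) (ecc v) then real (hops u v) else 0)"
  unfolding ecc_entry_def graph_dist_eq_hops[OF assms]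
    eccentricity_eq_ecc[OF assms(1)] eccentricity_eq_ecc[OF assms(2)]
  by (simp flip: of_nat_min)

sublocale E: symmetric_form V "ecc_entry G"
  using pair_finite_verts by unfold_locales (auto simp: ecc_entry_eq hops_sym min.commute)

lemma A_spectrum_eq: "A_spectrum G = E.spec"
  by (simp add: A_spectrum_def E.spec_def ecc_matrix_def vertex_matrix_def Let_def)

end

section \<open>Graphs without a universal vertex\<close>

text \<open>By the Leibniz formula the integer determinant is congruent to that of the identity,
  that is to 1, modulo \<open>m\<close>. With \<open>m \<ge> 2\<close> it cannot be 0, and the real
  determinant is the same number.\<close>

lemma nonsingular_on_identity_mod:
  fixes z :: "'a \<Rightarrow> 'a \<Rightarrow> int"
  assumes W: "finite W" and m: "m \<ge> 2"
    and a: "\<And>u v. u \<in> W \<Longrightarrow> v \<in> W \<Longrightarrow> a u v = real_of_int (z u v)"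
    and z: "\<And>u v. u \<in> W \<Longrightarrow> v \<in> W \<Longrightarrow> [z u v = (if u = v then 1 else 0)] (mod m)"
  shows "nonsingular_on W a"
  unfolding nonsingular_on_def
proof (intro allI impI ballI)
  fix x w assume eq: "\<forall>u\<in>W. (\<Sum>v\<in>W. a u v * x v) = 0" and w: "w \<in> W"
  define n where "n = card W"
  define f where "f = from_nat_into W"
  have f: "bij_betw f {..<n} W" unfolding f_def n_def by (rule bij_betw_from_nat_into_finite[OF W])
  have fW: "f i \<in> W" if "i < n" for i using f that by (auto simp: bij_betw_def)
  have inj: "f i = f j \<longleftrightarrow> i = j" if "i < n" "j < n" for i j
    using f that by (auto simp: bij_betw_def inj_on_def)
  let ?Z = "mat n n (\<lambda>(i, j). z (f i) (f j))"
  let ?A = "map_mat real_of_int ?Z"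
  have "[det ?Z = det (1\<^sub>m n)] (mod m)"
  proof -
    have "[?Z $$ (i, p i) = 1\<^sub>m n $$ (i, p i)] (mod m)" if "p permutes {0..<n}" "i \<in> {0..<n}" for p i
    proof -
      have "p i < n" using permutes_in_image[OF that(1), of i] that(2) by simp
      thus ?thesis using that(2) z[OF fW fW, of i "p i"] by (simp add: inj)
    qed
    thus ?thesis unfolding det_def'[OF mat_carrier] det_def'[OF one_carrier_mat]
      by (intro cong_sum cong_mult cong_refl cong_prod) auto
  qed
  hence "[det ?Z = 1] (mod m)" by simp
  hence "det ?Z \<noteq> 0" using m by (auto simp: cong_def)
  moreover have "det ?A = real_of_int (det ?Z)" by (rule of_int_hom.hom_det)
  ultimately have det: "det ?A \<noteq> 0" by simp
  let ?v = "vec n (x \<circ> f)"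
  have "(?A *\<^sub>v ?v) $ i = 0" if i: "i < n" for i
  proof -
    have "(?A *\<^sub>v ?v) $ i = (\<Sum>j<n. a (f i) (f j) * x (f j))"
      using i fW a by (simp add: scalar_prod_def lessThan_atLeast0)
    also have "\<dots> = (\<Sum>v\<in>W. a (f i) v * x v)" by (rule sum.reindex_bij_betw[OF f])
    finally show ?thesis using eq fW[OF i] by simp
  qed
  hence "?A *\<^sub>v ?v = 0\<^sub>v n" by auto
  moreover have "?A \<in> carrier_mat n n" by simp
  ultimately have v0: "?v = 0\<^sub>v n"
    using det det_0_iff_vec_prod_zero_field vec_carrier by blast
  obtain i where i: "i < n" "w = f i" using f w by (auto simp: bij_betw_def)
  have "x w = ?v $ i" using i by simp
  also have "\<dots> = 0" unfolding v0 using i by simp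
  finally show "x w = 0" .
qed

context finite_connected_graph
begin

abbreviation N where "N \<equiv> shifted (- 1) (ecc_entry G)"

lemma hops_self [simp]: "v \<in> V \<Longrightarrow> hops v v = 0"
  by (simp add: hops_0_iff)

lemma N_eq:
  assumes "u \<in> V" "v \<in> V"
  shows "N u v = (if u = v then 1 else if hops u v = min (ecc u) (ecc v) then real (hops u v) else 0)"
  using assms by (auto simp: shifted_def ecc_entry_eq hops_0_iff)

text \<open>Inside the class, an off-diagonal entry of \<open>N\<close> is either 0 or the common
  eccentricity \<open>e\<close>, so \<open>N\<close> is the identity modulo
  \<open>e\<close>.\<close>

lemma nonsingular_eccentricity_class:
  assumes "e \<ge> 2"
  shows "nonsingular_on {v \<in> V. ecc v = e} N"
  using assms pair_finite_verts
  by (intro nonsingular_on_identity_mod[where m = "int e" and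
        z = "\<lambda>u v. if u = v then 1 else if hops u v = e then int e else 0"])
    (auto simp: N_eq cong_0_iff hops_0_iff)

lemma card_eccentricity_class:
  assumes "e \<ge> 2"
  shows "count E.spec (- 1) + card {v \<in> V. ecc v = e} \<le> card V"
  by (intro E.nonsingular_on_imp_count nonsingular_eccentricity_class assms) auto

text \<open>Eliminating all variables but \<open>x 0\<close> leaves the coefficient 1 - \<Sum> (b
  i)^2. The sum of squares is 0 or at least 4, never 1.\<close>

lemma arrow_nonsingular:
  fixes b :: "nat \<Rightarrow> real" and m :: nat
  assumes b: "\<And>i. 1 \<le> i \<Longrightarrow> i \<le> m \<Longrightarrow> b i = 0 \<or> b i \<ge> 2"
    and eq0: "x 0 + (\<Sum>i=1..m. b i * x i) = 0"
    and eq: "\<And>i. 1 \<le> i \<Longrightarrow> i \<le> m \<Longrightarrow> b i * x 0 + x i = 0"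
    and "i \<le> m"
  shows "x i = 0"
proof -
  have "(\<Sum>i=1..m. b i * x i) = (\<Sum>i=1..m. - (b i)\<^sup>2 * x 0)"
  proof (intro sum.cong refl)
    fix i assume "i \<in> {1..m}"
    hence "x i = - (b i * x 0)" using eq[of i] by simp
    thus "b i * x i = - (b i)\<^sup>2 * x 0" by (simp add: power2_eq_square)
  qed
  also have "\<dots> = - (\<Sum>i=1..m. (b i)\<^sup>2) * x 0" by (simp add: sum_negf sum_distrib_right)
  finally have "x 0 * (1 - (\<Sum>i=1..m. (b i)\<^sup>2)) = 0"
    using eq0 by (simp add: algebra_simps)
  moreover have "(\<Sum>i=1..m. (b i)\<^sup>2) \<noteq> 1"
  proof (cases "\<forall>i\<in>{1..m}. b i = 0")
    case False
    then obtain i where "i \<in> {1..m}" "b i \<noteq> 0" by blast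
    hence i: "i \<in> {1..m}" "b i \<ge> 2" using b[of i] by auto
    have "2\<^sup>2 \<le> (b i)\<^sup>2" using i by (intro power_mono) auto
    also have "\<dots> \<le> (\<Sum>i=1..m. (b i)\<^sup>2)" using i by (intro member_le_sum) auto
    finally show ?thesis by simp
  qed simp
  ultimately have "x 0 = 0" by simp
  thus ?thesis using eq[of i] \<open>i \<le> m\<close> by (cases "i = 0") auto
qed

lemma diameter_bound:
  assumes uv: "u \<in> V" "v \<in> V" and d: "hops u v \<ge> 6"
  shows "count E.spec (- 1) + 6 \<le> card V"
proof -
  let ?d = "hops u v"
  obtain p where pV: "\<And>i. i \<le> ?d \<Longrightarrow> p i \<in> V" and ends: "p 0 = u" "p ?d = v"
    and dist: "\<And>i j. i \<le> j \<Longrightarrow> j \<le> ?d \<Longrightarrow> hops (p i) (p j) = j - i"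
    using geodesic[OF uv] by metis
  have ecc1: "i \<le> ecc (p i)" and ecc2: "?d - i \<le> ecc (p i)" if "i \<le> ?d" for i
    using hops_le_ecc[OF uv(1), of "p i"] hops_le_ecc[OF uv(2), of "p i"] dist[of 0 i] dist[of i ?d]
      hops_sym[OF pV[OF that] uv(2)] ends that by auto
  have inj: "inj_on p {..5}"
  proof (rule linorder_inj_onI)
    fix i j :: nat assume "i < j" "i \<in> {..5}" "j \<in> {..5}"
    hence "hops (p i) (p j) \<noteq> 0" using dist[of i j] d by simp
    thus "p i \<noteq> p j" using hops_0_iff[OF pV pV, of i j] d \<open>j \<in> {..5}\<close> \<open>i < j\<close> by auto
  qed auto
  define b where "b i = N (p 0) (p i)" for i
  have Np: "N (p i) (p j) = (if i = j then 1 else if i = 0 then b j else if j = 0 then b i else 0)"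
    if "i \<le> 5" "j \<le> 5" for i j
  proof -
    \<comment> \<open>Here \<open>ecc (p i) \<ge> ?d - i > j - i\<close> because j \<le> 5 <
      \<open>?d\<close>, and \<open>ecc (p j) \<ge> j > j - i\<close> because i \<ge> 1. The
      distance is thus below both eccentricities, and only the row and column of \<open>p 0\<close>
      can contain further nonzero entries.\<close>
    have zero: "N (p i) (p j) = 0 \<and> N (p j) (p i) = 0" if "1 \<le> i" "i < j" "j \<le> 5" for i j
    proof -
      have h: "hops (p i) (p j) = j - i" "hops (p j) (p i) = j - i"
        using dist[of i j] that d hops_sym[of "p i" "p j"] pV by auto
      have "p i \<noteq> p j" using inj that by (auto dest: inj_onD)
      moreover have "j - i < min (ecc (p i)) (ecc (p j))" using ecc2[of i] ecc1[of j] that d by auto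
      ultimately show ?thesis using h pV that d by (auto simp: N_eq)
    qed
    have sym: "N (p i) (p j) = N (p j) (p i)"
      using E.sym[OF pV pV, of i j] that d by (auto simp: shifted_def)
    show ?thesis
      using zero[of i j] zero[of j i] that sym pV d
      by (cases i j rule: linorder_cases) (auto simp: b_def N_eq)
  qed
  \<comment> \<open>The entry is 0 or the distance i. The value 1, which would allow a sum of
    squares equal to 1, is excluded because \<open>p 0\<close> and \<open>p 1\<close> both have
    eccentricity above 1.\<close>
  have b: "b i = 0 \<or> b i \<ge> 2" if "1 \<le> i" "i \<le> 5" for i
  proof -
    have "p 0 \<noteq> p i" using inj that by (auto dest: inj_onD)
    moreover have "hops (p 0) (p i) = i" using dist[of 0 i] that d by simp
    moreover have "1 < min (ecc (p 0)) (ecc (p 1))" using ecc2[of 0] ecc2[of 1] d by auto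
    ultimately show ?thesis
      unfolding b_def using N_eq[OF pV pV, of 0 i] that d by (cases "i = 1") auto
  qed
  have "nonsingular_on (p ` {..5}) N"
    unfolding nonsingular_on_def
  proof (intro allI impI ballI)
    fix x w assume eq: "\<forall>u\<in>p ` {..5}. (\<Sum>v\<in>p ` {..5}. N u v * x v) = 0" and "w \<in> p ` {..5}"
    then obtain k where k: "k \<le> 5" "w = p k" by auto
    have eq': "(\<Sum>j\<in>{..5}. (if i = j then 1 else if i = 0 then b j else if j = 0 then b i else 0) * x (p j)) = 0"
      if "i \<le> 5" for i
      using bspec[OF eq, of "p i"] that by (simp add: sum.reindex[OF inj] Np cong: if_cong)
    have split: "{..5} = insert 0 {1..5::nat}" by auto
    have "(x \<circ> p) k = 0"
    proof (rule arrow_nonsingular[OF b])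
      show "(x \<circ> p) 0 + (\<Sum>i=1..5. b i * (x \<circ> p) i) = 0"
      proof -
        have "(\<Sum>i=1..5. b i * (x \<circ> p) i) = (\<Sum>j\<in>{1..5}.
            (if 0 = j then 1 else if 0 = (0 :: nat) then b j else if j = 0 then b 0 else 0) * x (p j))"
          by (intro sum.cong) auto
        thus ?thesis using eq'[of 0] unfolding split by simp
      qed
      show "b i * (x \<circ> p) 0 + (x \<circ> p) i = 0" if "1 \<le> i" "i \<le> 5" for i
      proof -
        have "(\<Sum>j=1..5. (if i = j then 1 else if i = 0 then b j else if j = 0 then b i else 0) * x (p j))
            = (\<Sum>j=1..5. if i = j then x (p j) else 0)"
          using that by (intro sum.cong) auto
        also have "\<dots> = x (p i)" using that by simp
        finally show ?thesis using eq'[of i] that unfolding split by simp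
      qed
    qed (use k in auto)
    thus "x w = 0" using k by simp
  qed
  moreover have "p ` {..5} \<subseteq> V" using pV d by (intro image_subsetI) simp
  ultimately show ?thesis
    using E.nonsingular_on_imp_count[of "p ` {..5}" "- 1"] card_image[OF inj] by simp
qed

text \<open>Three classes of at most 5 vertices each. All distances are at most 5, and a vertex of
  eccentricity 2 brings them down to 4 through the triangle inequality, so eccentricities 2 and 5 do
  not both occur.\<close>

lemma no_universal_vertex_bound:
  assumes mult: "card V \<le> count E.spec (- 1) + 5" and ecc: "\<And>v. v \<in> V \<Longrightarrow> ecc v \<ge> 2"
  shows "card V \<le> 15"
proof -
  let ?C = "\<lambda>e. {v \<in> V. ecc v = e}"
  have C: "card (?C e) \<le> 5" if "e \<ge> 2" for e
    using card_eccentricity_class[OF that] mult by linarith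
  have five: "hops u v \<le> 5" if "u \<in> V" "v \<in> V" for u v
    using diameter_bound[OF that] mult by linarith
  have three: "card V \<le> 15" if "V \<subseteq> ?C e1 \<union> ?C e2 \<union> ?C e3" "e1 \<ge> 2" "e2 \<ge> 2" "e3 \<ge> 2" for e1 e2 e3
  proof -
    have "card V \<le> card (?C e1 \<union> ?C e2 \<union> ?C e3)"
      using that(1) pair_finite_verts by (intro card_mono) auto
    also have "\<dots> \<le> card (?C e1) + card (?C e2) + card (?C e3)"
      using card_Un_le[of "?C e1 \<union> ?C e2" "?C e3"] card_Un_le[of "?C e1" "?C e2"] by linarith
    finally show ?thesis using C[of e1] C[of e2] C[of e3] that by linarith
  qed
  have ecc5: "ecc v \<le> 5" if "v \<in> V" for v
    using ecc_attained[OF that] five that by metis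
  show ?thesis
  proof (cases "\<exists>c\<in>V. ecc c = 2")
    case True
    then obtain c where c: "c \<in> V" "ecc c = 2" by blast
    have "ecc v \<le> 4" if v: "v \<in> V" for v
    proof -
      obtain u where u: "u \<in> V" "hops u v = ecc v" using ecc_attained[OF v] .
      show ?thesis
        using hops_triangle[OF u(1) c(1) v] hops_le_ecc[OF u(1), of c] hops_le_ecc[OF v, of c]
          hops_sym[OF c(1) v] u c by linarith
    qed
    hence "V \<subseteq> ?C 2 \<union> ?C 3 \<union> ?C 4" using ecc by (fastforce simp: le_Suc_eq numeral_eq_Suc)
    thus ?thesis by (rule three) auto
  next
    case False
    hence "ecc v \<in> {3, 4, 5}" if "v \<in> V" for v
      using ecc[OF that] ecc5[OF that] that by (auto simp: numeral_eq_Suc le_Suc_eq)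
    hence "V \<subseteq> ?C 3 \<union> ?C 4 \<union> ?C 5" by auto
    thus ?thesis by (rule three) auto
  qed
qed

end

section \<open>Seidel matrices of order four and five\<close>

text \<open>The Seidel entry of an adjacent (\<open>True\<close>) or nonadjacent (\<open>False\<close>) pair.\<close>

abbreviation sg :: "bool \<Rightarrow> real" where "sg b \<equiv> (if b then - 1 else 1)"

text \<open>
  Three edges covering all of \<open>1, 2, 3, 4\<close> form a path or a star; the degree bound excludes the star.
\<close>

definition four_path :: "bool \<Rightarrow> bool \<Rightarrow> bool \<Rightarrow> bool \<Rightarrow> bool \<Rightarrow> bool \<Rightarrow> bool" where
  "four_path t12 t13 t14 t23 t24 t34 \<longleftrightarrow>
    of_bool t12 + of_bool t13 + of_bool t14 + of_bool t23 + of_bool t24 + of_bool t34 = (3 :: nat) \<and>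
    of_bool t12 + of_bool t13 + of_bool t14 \<in> {1, 2 :: nat} \<and>
    of_bool t12 + of_bool t23 + of_bool t24 \<in> {1, 2 :: nat} \<and>
    of_bool t13 + of_bool t23 + of_bool t34 \<in> {1, 2 :: nat} \<and>
    of_bool t14 + of_bool t24 + of_bool t34 \<in> {1, 2 :: nat}"

text \<open>The 4!/2 = 12 labelled paths on four vertices, so that a case split over sign patterns
  dismisses them by rewriting.\<close>

lemma four_path_eqs:
  "four_path False False True True False True"
  "four_path False False True True True False"
  "four_path False True False False True True"
  "four_path False True False True True False"
  "four_path False True True False True False"
  "four_path False True True True False False"
  "four_path True False False False True True"
  "four_path True False False True False True"
  "four_path True False True False False True"
  "four_path True False True True False False"
  "four_path True True False False False True"
  "four_path True True False False True False"
  by (simp_all add: four_path_def)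

text \<open>Vertex 0 is isolated, so its Seidel entries are all 1. Of the 64 graphs on the other
  four vertices the 12 paths contradict the hypothesis; the other 52 systems have constant
  coefficients and fall to linear arithmetic.\<close>

lemma seidel_5_switched:
  fixes y0 y1 y2 y3 y4 :: real
  assumes "y1 + y2 + y3 + y4 = 0"
    and "y0 + sg t12 * y2 + sg t13 * y3 + sg t14 * y4 = 0"
    and "y0 + sg t12 * y1 + sg t23 * y3 + sg t24 * y4 = 0"
    and "y0 + sg t13 * y1 + sg t23 * y2 + sg t34 * y4 = 0"
    and "y0 + sg t14 * y1 + sg t24 * y2 + sg t34 * y3 = 0"
    and "\<not> four_path t12 t13 t14 t23 t24 t34"
  shows "y0 = 0 \<and> y1 = 0 \<and> y2 = 0 \<and> y3 = 0 \<and> y4 = 0"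
  by (insert assms(6,1-5), (induct t12; induct t13; induct t14; induct t23; induct t24; induct t34;
      ((simp only: four_path_eqs simp_thms; fail) | (simp (no_asm_use) only: if_True if_False, (intro conjI; linarith)))))

text \<open>The determinant is odd, being congruent to det (J - I) = -3 modulo 2. The proof instead
  solves the system for each of the 64 sign patterns.\<close>

lemma seidel_4:
  fixes y1 y2 y3 y4 :: real
  assumes "sg t12 * y2 + sg t13 * y3 + sg t14 * y4 = 0"
    and "sg t12 * y1 + sg t23 * y3 + sg t24 * y4 = 0"
    and "sg t13 * y1 + sg t23 * y2 + sg t34 * y4 = 0"
    and "sg t14 * y1 + sg t24 * y2 + sg t34 * y3 = 0"
  shows "y1 = 0 \<and> y2 = 0 \<and> y3 = 0 \<and> y4 = 0"
  by (insert assms, (induct t12; induct t13; induct t14; induct t23; induct t24; induct t34;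
      (simp (no_asm_use) only: if_True if_False, (intro conjI; linarith))))

text \<open>
  Small graphs on the vertices \<open>0, \<dots>, h - 1\<close> are coded by the lists of their edges \<open>(i, j)\<close>, \<open>i < j\<close>.
\<close>

definition code_adj :: "(nat \<times> nat) list \<Rightarrow> nat \<Rightarrow> nat \<Rightarrow> bool" where
  "code_adj es i j \<longleftrightarrow> (i, j) \<in> set es \<or> (j, i) \<in> set es"

section \<open>Evaluation over the graphs on four and five vertices\<close>

primrec insertions :: "'a \<Rightarrow> 'a list \<Rightarrow> 'a list list" where
  "insertions x [] = [[x]]"
| "insertions x (y # ys) = (x # y # ys) # map ((#) y) (insertions x ys)"

text \<open>Orderings of a list in executable form, so that evaluation can search for isomorphisms
  between small graphs.\<close>

primrec arrangements :: "'a list \<Rightarrow> 'a list list" where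
  "arrangements [] = [[]]"
| "arrangements (x # xs) = concat (map (insertions x) (arrangements xs))"

lemma set_insertions: "ys \<in> set (insertions x xs) \<Longrightarrow> mset ys = add_mset x (mset xs)"
  by (induction xs arbitrary: ys) auto

lemma mset_arrangements: "ys \<in> set (arrangements xs) \<Longrightarrow> mset ys = mset xs"
  by (induction xs arbitrary: ys) (auto dest: set_insertions)

text \<open>Of the 11 graphs on four vertices four have a universal vertex; the other seven stand
  here in the order of \<open>in_G1\<close>.\<close>

definition codes4 :: "(nat \<times> nat) list list" where
  "codes4 = [[], [(2, 3)], [(0, 1), (1, 2)], [(0, 1), (2, 3)], [(0, 1), (1, 2), (2, 3)],
     [(0, 1), (1, 2), (0, 2)], [(0, 1), (1, 2), (2, 3), (0, 3)]]"

definition codes5 :: "(nat \<times> nat) list list" where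
  "codes5 = [[(0, 1), (1, 2), (2, 3), (3, 4), (0, 4)], [(1, 2), (2, 3), (3, 4)],
     [(0, 1), (1, 2), (0, 2), (0, 3), (1, 4)]]"

definition pairs :: "nat \<Rightarrow> (nat \<times> nat) list" where
  "pairs h = concat (map (\<lambda>j. map (\<lambda>i. (i, j)) [0..<j]) [0..<h])"

definition same_code :: "nat \<Rightarrow> (nat \<times> nat) list \<Rightarrow> (nat \<times> nat) list \<Rightarrow> nat list \<Rightarrow> bool" where
  "same_code h es fs p \<longleftrightarrow>
    (\<forall>(i, j)\<in>set (pairs h). code_adj es (p ! i) (p ! j) \<longleftrightarrow> code_adj fs i j)"

definition has_universal :: "nat \<Rightarrow> (nat \<times> nat) list \<Rightarrow> bool" where
  "has_universal h es \<longleftrightarrow> (\<exists>i\<in>set [0..<h]. \<forall>j\<in>set [0..<h]. i = j \<or> code_adj es i j)"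

lemma codes4_exhaustive:
  "\<forall>es\<in>set (subseqs (pairs 4)). has_universal 4 es \<or>
    (\<exists>fs\<in>set codes4. \<exists>p\<in>set (arrangements [0..<4]). same_code 4 es fs p)"
  by code_simp

text \<open>
  The graph obtained from the isolated vertex 0 and the path 1, 2, 3, 4 by switching with respect to
  the set of those \<open>i\<close> for which \<open>b ! (i - 1)\<close>, which becomes the neighbourhood of 0.
\<close>

definition path_switch :: "bool list \<Rightarrow> nat \<Rightarrow> nat \<Rightarrow> bool" where
  "path_switch b i j \<longleftrightarrow>
    (if i = 0 then b ! (j - 1) else if j = 0 then b ! (i - 1)
     else (i + 1 = j \<or> j + 1 = i) \<noteq> (b ! (i - 1) \<noteq> b ! (j - 1)))"

text \<open>Complementary switching sets give the same graph, so vertex 0 may stay outside and 16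
  sets suffice. Apart from graphs with a universal vertex, the switching class of K1 \<union> P4
  contains only C5, K1 \<union> P4 and the bull.\<close>

lemma codes5_exhaustive:
  "\<forall>b\<in>set (List.n_lists 4 [False, True]).
    (\<exists>i\<in>set [0..<5]. \<forall>j\<in>set [0..<5]. i = j \<or> path_switch b i j) \<or>
    (\<exists>fs\<in>set codes5. \<exists>p\<in>set (arrangements [0..<5]).
      \<forall>(i, j)\<in>set (pairs 5). path_switch b (p ! i) (p ! j) \<longleftrightarrow> code_adj fs i j)"
  by code_simp


text \<open>Passes from the degree counts of \<open>four_path\<close> to an actual ordering of the
  vertices along the path.\<close>

lemma four_path_arrangement:
  "\<forall>es\<in>set (subseqs [(1, 2), (1, 3), (1, 4), (2, 3), (2, 4), (3, 4)]).
    four_path (code_adj es 1 2) (code_adj es 1 3) (code_adj es 1 4)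
      (code_adj es 2 3) (code_adj es 2 4) (code_adj es 3 4) \<longrightarrow>
    (\<exists>p\<in>set (arrangements [1, 2, 3, 4]).
      \<forall>(i, j)\<in>set (pairs 4). code_adj es (p ! i) (p ! j) \<longleftrightarrow> i + 1 = j)"
  by code_simp

text \<open>Absence of a universal vertex ensures that, in a cone over the coded graph, the coded
  vertices are exactly the nonuniversal ones.\<close>

definition proper_code :: "nat \<Rightarrow> (nat \<times> nat) list \<Rightarrow> bool" where
  "proper_code h es \<longleftrightarrow> (\<forall>(i, j)\<in>set es. i < j \<and> j < h) \<and> \<not> has_universal h es"

lemma proper_codes:
  "\<forall>es\<in>set codes4. proper_code 4 es" "\<forall>es\<in>set codes5. proper_code 5 es"
  by code_simp+

lemma set_pairs: "set (pairs h) = {(i, j). i < j \<and> j < h}"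
  by (auto simp: pairs_def)

lemma code_adj_filter:
  assumes "i < j" "j < h"
  shows "code_adj (filter (\<lambda>(i, j). r i j) (pairs h)) i j \<longleftrightarrow> r i j"
  using assms by (auto simp: code_adj_def set_pairs)

lemma bij_betw_arrangement:
  assumes "p \<in> set (arrangements [0..<h])"
  shows "bij_betw ((!) p) {..<h} {..<h}"
proof -
  have "mset p = mset [0..<h]" using mset_arrangements[OF assms] .
  note m = this
  have "length p = h" using mset_eq_length[OF m] by simp
  moreover have "distinct p" using mset_eq_imp_distinct_iff[OF m] by simp
  moreover have "set p = {..<h}" using mset_eq_setD[OF m] by (simp add: atLeast0LessThan)
  ultimately show ?thesis by (intro bij_betw_nth) auto
qed

lemma seidel_5:
  fixes x0 x1 x2 x3 x4 :: real
  assumes "sg a1 * x1 + sg a2 * x2 + sg a3 * x3 + sg a4 * x4 = 0"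
    and "sg a1 * x0 + sg e12 * x2 + sg e13 * x3 + sg e14 * x4 = 0"
    and "sg a2 * x0 + sg e12 * x1 + sg e23 * x3 + sg e24 * x4 = 0"
    and "sg a3 * x0 + sg e13 * x1 + sg e23 * x2 + sg e34 * x4 = 0"
    and "sg a4 * x0 + sg e14 * x1 + sg e24 * x2 + sg e34 * x3 = 0"
    and "x0 \<noteq> 0 \<or> x1 \<noteq> 0 \<or> x2 \<noteq> 0 \<or> x3 \<noteq> 0 \<or> x4 \<noteq> 0"
  shows "four_path (e12 \<noteq> (a1 \<noteq> a2)) (e13 \<noteq> (a1 \<noteq> a3)) (e14 \<noteq> (a1 \<noteq> a4))
    (e23 \<noteq> (a2 \<noteq> a3)) (e24 \<noteq> (a2 \<noteq> a4)) (e34 \<noteq> (a3 \<noteq> a4))"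
proof (rule ccontr)
  \<comment> \<open>Switching at the neighbours of vertex 0 makes 0 isolated and replaces \<open>x\<^sub>j\<close> by \<open>sg a\<^sub>j * x\<^sub>j\<close>.\<close>
  assume not: "\<not> ?thesis"
  have sw: "sg (e \<noteq> (a \<noteq> b)) * (sg b * x) = sg a * (sg e * x)"
    "sg (e \<noteq> (b \<noteq> a)) * (sg b * x) = sg a * (sg e * x)" for e a b and x :: real
    by auto
  have one: "x = sg a * (sg a * x)" for a and x :: real by simp
  have row: "x0 + sg a * y + sg a * z + sg a * t = 0"
    if "sg a * x0 + y + z + t = 0" for a y z t
  proof -
    have "x0 + sg a * y + sg a * z + sg a * t = sg a * (sg a * x0 + y + z + t)" by (cases a) auto
    thus ?thesis using that by simp
  qed
  note zero = seidel_5_switched[OF assms(1) _ _ _ _ not, of x0, unfolded sw]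
  have "x0 = 0 \<and> sg a1 * x1 = 0 \<and> sg a2 * x2 = 0 \<and> sg a3 * x3 = 0 \<and> sg a4 * x4 = 0"
    by (rule zero) (rule row, use assms in simp)+
  thus False using assms(6) by (simp split: if_splits)
qed

section \<open>Graphs with a universal vertex\<close>

text \<open>The join of a complete graph with the coded graph, described inside \<open>G\<close>
  without a model graph: \<open>w\<close> labels the coded vertices, and every other vertex is
  universal.\<close>

definition cone_over :: "nat \<Rightarrow> (nat \<times> nat) list \<Rightarrow> 'a pair_pre_digraph \<Rightarrow> bool" where
  "cone_over h es G \<longleftrightarrow> (\<exists>w. inj_on w {..<h} \<and> w ` {..<h} \<subseteq> pverts G \<and>
    (\<forall>i j. i < j \<longrightarrow> j < h \<longrightarrow> ((w i, w j) \<in> parcs G \<longleftrightarrow> code_adj es i j)) \<and>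
    (\<forall>u\<in>pverts G - w ` {..<h}. \<forall>v\<in>pverts G. u \<noteq> v \<longrightarrow> (u, v) \<in> parcs G))"

lemma sum_lessThan_4: "(\<Sum>j<4. f j) = f 0 + f 1 + f 2 + f (3 :: nat)"
  by (simp add: eval_nat_numeral lessThan_Suc add_ac)

lemma sum_lessThan_5: "(\<Sum>j<5. f j) = f 0 + f 1 + f 2 + f 3 + f (4 :: nat)"
  by (simp add: eval_nat_numeral lessThan_Suc add_ac)

lemma all_less_5: "(\<forall>i<5. P i) \<longleftrightarrow> P 0 \<and> P 1 \<and> P 2 \<and> P 3 \<and> P (4 :: nat)"
  by (auto simp: eval_nat_numeral less_Suc_eq)

text \<open>In C5 every Seidel row has two entries 1 and two entries -1, which gives the all-ones
  vector; switching and relabelling turn it into sign vectors for the other two graphs. The nonzero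
  coordinate sum is what later makes the rows of the five vertices determine all rows of
  \<open>N\<close>.\<close>

lemma codes5_kernel:
  assumes "es \<in> set codes5"
  shows "\<exists>ys :: real list.
    (\<forall>i<5. (\<Sum>j<5. (if i = j then 0 else sg (code_adj es i j)) * ys ! j) = 0) \<and> (\<Sum>j<5. ys ! j) \<noteq> 0"
proof -
  consider "es = codes5 ! 0" | "es = codes5 ! 1" | "es = codes5 ! 2"
    using assms by (auto simp: codes5_def)
  thus ?thesis
  proof cases
    case 1
    show ?thesis unfolding all_less_5 1
      by (rule exI[of _ "[1, 1, 1, 1, 1]"]) (simp add: codes5_def code_adj_def sum_lessThan_5)
  next
    case 2
    show ?thesis unfolding all_less_5 2
      by (rule exI[of _ "[- 1, 1, - 1, - 1, 1]"]) (simp add: codes5_def code_adj_def sum_lessThan_5)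
  next
    case 3
    show ?thesis unfolding all_less_5 3
      by (rule exI[of _ "[1, 1, - 1, 1, 1]"]) (simp add: codes5_def code_adj_def sum_lessThan_5)
  qed
qed

context finite_connected_graph
begin

text \<open>The nonuniversal vertices. The definition avoids eccentricities, so it applies before a
  universal vertex is known to exist; once one exists, these are the vertices of eccentricity
  2.\<close>

definition core :: "'a set" where
  "core = {u \<in> V. \<exists>v\<in>V. u \<noteq> v \<and> \<not> adj u v}"

definition seidel :: "'a \<Rightarrow> 'a \<Rightarrow> real" where
  "seidel u v = (if u = v then 0 else sg (adj u v))"

lemma seidel_sym: "seidel u v = seidel v u"
  using adj_sym[of u v] by (simp add: seidel_def)

lemma core_subset: "core \<subseteq> V" by (auto simp: core_def)

lemma finite_core: "finite core"
  using core_subset pair_finite_verts by (rule finite_subset)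

lemma universal_adj: "u \<in> V - core \<Longrightarrow> v \<in> V \<Longrightarrow> u \<noteq> v \<Longrightarrow> adj u v"
  by (auto simp: core_def)

text \<open>Nonadjacency is symmetric, so a nonneighbour of a core vertex is again in the core.
  Hence the graph induced on the core has no universal vertex.\<close>

lemma core_nonadjacent:
  assumes "u \<in> core"
  obtains v where "v \<in> core" "u \<noteq> v" "\<not> adj u v"
proof -
  obtain v where v: "u \<in> V" "v \<in> V" "u \<noteq> v" "\<not> adj u v" using assms unfolding core_def by blast
  hence "\<not> adj v u" using adj_sym[of u v] by simp
  hence "v \<in> core" using v(1-3) unfolding core_def by auto
  thus ?thesis using that v by blast
qed

lemma ecc_core_ge: "u \<in> core \<Longrightarrow> ecc u \<ge> 2"
proof -
  assume u: "u \<in> core"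
  then obtain v where v: "v \<in> core" "u \<noteq> v" "\<not> adj u v" by (rule core_nonadjacent)
  have uv: "u \<in> V" "v \<in> V" using u v core_subset by auto
  have "hops v u \<noteq> 0" "hops v u \<noteq> 1"
    using hops_0_iff[of v u] hops_1_iff[of v u] adj_sym[of u v] uv v by auto
  thus ?thesis using hops_le_ecc[of v u] uv by linarith
qed

section \<open>The rank of \<open>N\<close> in the presence of a universal vertex\<close>

context
  fixes c assumes c: "c \<in> V - core" and two: "card V \<ge> 2"
begin

lemma hops_universal: "u \<in> V - core \<Longrightarrow> v \<in> V \<Longrightarrow> hops u v = (if u = v then 0 else 1)"
  using hops_1_iff universal_adj by auto

text \<open>At least two vertices are required here: in the one-vertex graph the eccentricity would
  be 0.\<close>

lemma ecc_universal:
  assumes u: "u \<in> V - core"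
  shows "ecc u = 1"
proof -
  have h: "hops v u = (if u = v then 0 else 1)" if "v \<in> V" for v
    using hops_universal[OF u that] hops_sym u that by simp
  obtain v where "v \<in> V" "v \<noteq> u"
    using two u by (metis One_nat_def card.infinite card_le_Suc0_iff_eq not_less_eq_eq numeral_2_eq_2 zero_le)
  hence "ecc u \<ge> 1" using hops_le_ecc[of v u] h[of v] by simp
  moreover have "ecc u \<le> 1" using ecc_attained[of u] h u by (metis Diff_iff le_numeral_extra(4) zero_le_one)
  ultimately show ?thesis by simp
qed

lemma ecc_core:
  assumes u: "u \<in> core"
  shows "ecc u = 2"
proof -
  have uV: "u \<in> V" using u core_subset by auto
  obtain v where v: "v \<in> V" "hops v u = ecc u" using ecc_attained[OF uV] .
  have "hops v u \<le> hops v c + hops c u" using hops_triangle[of v c u] v uV c by simp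
  also have "\<dots> \<le> 2" using hops_universal[OF c v(1)] hops_universal[OF c uV] hops_sym c v by simp
  finally show ?thesis using ecc_core_ge[OF u] v by simp
qed

lemma core_eq_class: "core = {v \<in> V. ecc v = 2}"
  using ecc_core ecc_universal core_subset by fastforce

lemma N_universal:
  assumes "u \<in> V" "v \<in> V" "u \<notin> core \<or> v \<notin> core"
  shows "N u v = 1"
proof -
  have N: "N u v = 1" if u: "u \<in> V - core" and v: "v \<in> V" for u v
  proof (cases "u = v")
    case False
    have "ecc v \<ge> 1" using ecc_universal[of v] ecc_core[of v] v by (cases "v \<in> core") auto
    thus ?thesis using False u v hops_universal[OF u v] ecc_universal[OF u] by (simp add: N_eq)
  qed (use that in \<open>auto simp: N_eq\<close>)
  have "N u v = N v u" using E.sym[OF assms(1,2)] by (simp add: shifted_def)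
  thus ?thesis using N[of u v] N[of v u] assms by auto
qed

text \<open>A nonadjacent pair has entry 2 = 1 + 1, an adjacent pair 0 = 1 - 1, and the diagonal is
  1. Together with \<open>N_universal\<close> this says that \<open>N\<close> = J + S, where S is
  \<open>seidel\<close> on the core and 0 elsewhere.\<close>

lemma N_core:
  assumes u: "u \<in> core" and v: "v \<in> core"
  shows "N u v = 1 + seidel u v"
proof -
  have V: "u \<in> V" "v \<in> V" using u v core_subset by auto
  have "hops u v \<le> 2" using hops_le_ecc[OF V(1), of v] ecc_core[OF v] by simp
  hence "hops u v = 2 \<longleftrightarrow> u \<noteq> v \<and> \<not> adj u v"
    using hops_0_iff[OF V] hops_1_iff[OF V] adj_irrefl by auto
  thus ?thesis using V ecc_core[OF u] ecc_core[OF v] by (auto simp: N_eq seidel_def)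
qed

lemma N_row:
  assumes u: "u \<in> V"
  shows "(\<Sum>v\<in>V. N u v * x v) =
    (\<Sum>v\<in>V. x v) + (if u \<in> core then \<Sum>v\<in>core. seidel u v * x v else 0)"
proof (cases "u \<in> core")
  case True
  have "(\<Sum>v\<in>V. N u v * x v) = (\<Sum>v\<in>V. x v + (if v \<in> core then seidel u v * x v else 0))"
    using True u N_core[OF True] N_universal[OF u] by (intro sum.cong) (auto simp: algebra_simps)
  also have "\<dots> = (\<Sum>v\<in>V. x v) + (\<Sum>v\<in>core. seidel u v * x v)"
    using core_subset pair_finite_verts by (simp add: sum.distrib sum.If_cases Int_absorb1)
  finally show ?thesis using True by simp
qed (use u N_universal[OF u] in simp)

text \<open>All universal vertices have the same all-ones row, so one of them and the core determine
  the rest.\<close>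

lemma count_ge_core: "card V \<le> count E.spec (- 1) + card core + 1"
proof -
  have "card V \<le> count E.spec (- 1) + card (insert c core)"
  proof (rule E.determining_rows_imp_count)
    fix x u assume eq: "\<And>u. u \<in> insert c core \<Longrightarrow> (\<Sum>v\<in>V. N u v * x v) = 0" and u: "u \<in> V"
    show "(\<Sum>v\<in>V. N u v * x v) = 0"
      using eq[of c] eq[of u] N_row[of c x] N_row[of u x] c u by (cases "u \<in> core") auto
  qed (use c core_subset in auto)
  thus ?thesis using c finite_core by simp
qed

lemma count_le_core: "count E.spec (- 1) + card core \<le> card V"
  using card_eccentricity_class[of 2] unfolding core_eq_class by simp

text \<open>On the core together with \<open>c\<close>, the equation of \<open>c\<close> says that
  all coordinates sum to 0. This removes J from the core equations and leaves the Seidel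
  system.\<close>

lemma count_le_core_nonsingular:
  assumes ns: "nonsingular_on core seidel"
  shows "count E.spec (- 1) + card core + 1 \<le> card V"
proof -
  have "nonsingular_on (insert c core) N"
    unfolding nonsingular_on_def
  proof (intro allI impI)
    fix x assume eq: "\<forall>u\<in>insert c core. (\<Sum>v\<in>insert c core. N u v * x v) = 0"
    have c': "c \<in> V" "c \<notin> core" using c by auto
    have sum: "(\<Sum>v\<in>insert c core. N u v * x v) = N u c * x c + (\<Sum>v\<in>core. N u v * x v)" for u
      using finite_core c' by simp
    have eqc: "x c + (\<Sum>v\<in>core. x v) = 0"
      using bspec[OF eq, of c] N_universal[OF c'(1)] c' core_subset unfolding sum by (simp add: subset_iff)
    have "(\<Sum>v\<in>core. seidel u v * x v) = 0" if u: "u \<in> core" for u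
    proof -
      have "(\<Sum>v\<in>core. N u v * x v) = (\<Sum>v\<in>core. x v) + (\<Sum>v\<in>core. seidel u v * x v)"
        using u by (simp add: N_core distrib_right sum.distrib)
      moreover have "N u c = 1" using N_universal[of u c] u c' core_subset by auto
      ultimately show ?thesis using bspec[OF eq, of u] u eqc unfolding sum by simp
    qed
    hence "\<forall>v\<in>core. x v = 0" using ns unfolding nonsingular_on_def by blast
    thus "\<forall>v\<in>insert c core. x v = 0" using eqc by simp
  qed
  from E.nonsingular_on_imp_count[OF _ this] show ?thesis using c core_subset finite_core by simp
qed

text \<open>Weighting the core equations by the kernel vector \<open>y\<close> cancels the Seidel
  part and leaves the total of \<open>x\<close> times the nonzero sum of \<open>y\<close>. So the
  core equations alone force the total to be 0, which is the equation of every universal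
  vertex.\<close>

lemma count_ge_core_singular:
  assumes y: "\<And>u. u \<in> core \<Longrightarrow> (\<Sum>v\<in>core. seidel u v * y v) = 0" "(\<Sum>v\<in>core. y v) \<noteq> 0"
  shows "card V \<le> count E.spec (- 1) + card core"
proof (rule E.determining_rows_imp_count[OF core_subset])
  fix x u assume eq: "\<And>u. u \<in> core \<Longrightarrow> (\<Sum>v\<in>V. N u v * x v) = 0" and u: "u \<in> V"
  let ?t = "\<Sum>v\<in>V. x v"
  have row: "?t + (\<Sum>v\<in>core. seidel u v * x v) = 0" if "u \<in> core" for u
    using eq[OF that] N_row[of u x] that core_subset by auto
  have "(\<Sum>u\<in>core. y u * (\<Sum>v\<in>core. seidel u v * x v)) = (\<Sum>u\<in>core. \<Sum>v\<in>core. seidel v u * y u * x v)"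
    unfolding sum_distrib_left
    by (intro sum.cong refl) (metis seidel_sym mult.assoc mult.commute)
  also have "\<dots> = (\<Sum>v\<in>core. (\<Sum>u\<in>core. seidel v u * y u) * x v)"
    unfolding sum_distrib_right by (rule sum.swap)
  also have "\<dots> = 0" using y by simp
  finally have "(\<Sum>u\<in>core. y u * (\<Sum>v\<in>core. seidel u v * x v)) = 0" .
  hence "?t * (\<Sum>u\<in>core. y u) = (\<Sum>u\<in>core. y u * (?t + (\<Sum>v\<in>core. seidel u v * x v)))"
    by (simp add: distrib_left sum.distrib sum_distrib_left mult.commute)
  also have "\<dots> = 0" using row by simp
  finally have "?t = 0" using y by simp
  thus "(\<Sum>v\<in>V. N u v * x v) = 0" using N_row[OF u, of x] row[of u] by auto
qed

end

section \<open>Recognizing the graph induced on the core\<close>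

lemma seidel_index:
  assumes "inj_on w {..<h}" "i < h" "j < h"
  shows "seidel (w i) (w j) = (if i = j then 0 else sg (adj (w i) (w j)))"
  using assms by (auto simp: seidel_def inj_on_def)

text \<open>Writing the smaller index first turns the two symmetric entries into the same sign
  variable, as the sign-pattern lemmas expect.\<close>

lemma seidel_index_min:
  assumes "inj_on w {..<h}" "i < h" "j < h"
  shows "seidel (w i) (w j) = (if i = j then 0 else sg (adj (w (min i j)) (w (max i j))))"
  using seidel_index[OF assms] adj_sym[of "w i" "w j"] by (simp add: min_def max_def)

lemma seidel_nonsingular_4:
  assumes "card core = 4"
  shows "nonsingular_on core seidel"
proof -
  obtain w :: "nat \<Rightarrow> 'a" where w: "bij_betw w {..<4} core"
    using finite_same_card_bij[of "{..<4::nat}" core] finite_core assms by auto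
  show ?thesis
    unfolding nonsingular_on_def
  proof (intro allI impI ballI)
    fix x u assume eq: "\<forall>u\<in>core. (\<Sum>v\<in>core. seidel u v * x v) = 0" and "u \<in> core"
    then obtain k where k: "k < 4" "u = w k" using w by (auto simp: bij_betw_def)
    have "(\<Sum>j<4. seidel (w i) (w j) * x (w j)) = 0" if "i < 4" for i
      using sum.reindex_bij_betw[OF w, of "\<lambda>v. seidel (w i) v * x v"] eq that w
      by (auto simp: bij_betw_def)
    note eqs = this[of 0] this[of 1] this[of 2] this[of 3]
    note index = seidel_index_min[OF bij_betw_imp_inj_on[OF w]]
    have "x (w 0) = 0 \<and> x (w 1) = 0 \<and> x (w 2) = 0 \<and> x (w 3) = 0"
      by (rule seidel_4[of "adj (w 0) (w 1)" _ "adj (w 0) (w 2)" _ "adj (w 0) (w 3)" _ _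
            "adj (w 1) (w 2)" "adj (w 1) (w 3)" "adj (w 2) (w 3)"])
        (use eqs in \<open>simp_all add: index sum_lessThan_4 del: One_nat_def split del: if_split\<close>)
    moreover have "k = 0 \<or> k = 1 \<or> k = 2 \<or> k = 3" using k by auto
    ultimately show "x u = 0" using k by auto
  qed
qed

lemma cone_over_core:
  assumes w: "bij_betw w {..<h} core" and "\<And>i j. i < j \<Longrightarrow> j < h \<Longrightarrow> adj (w i) (w j) \<longleftrightarrow> code_adj es i j"
  shows "cone_over h es G"
  unfolding cone_over_def
  using assms core_subset universal_adj by (intro exI[of _ w]) (auto simp: bij_betw_def)

lemma cone_over_4:
  assumes "card core = 4"
  shows "\<exists>es\<in>set codes4. cone_over 4 es G"
proof -
  obtain w :: "nat \<Rightarrow> 'a" where w: "bij_betw w {..<4} core"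
    using finite_same_card_bij[of "{..<4::nat}" core] finite_core assms by auto
  define es where "es = filter (\<lambda>(i, j). adj (w i) (w j)) (pairs 4)"
  have adj: "adj (w i) (w j) \<longleftrightarrow> code_adj es i j" if "i \<noteq> j" "i < 4" "j < 4" for i j
    using code_adj_filter[of i j 4 "\<lambda>i j. adj (w i) (w j)"]
      code_adj_filter[of j i 4 "\<lambda>i j. adj (w i) (w j)"] that adj_sym[of "w i" "w j"]
    unfolding es_def by (cases i j rule: linorder_cases) (auto simp: code_adj_def)
  have "\<not> has_universal 4 es"
  proof
    assume "has_universal 4 es"
    then obtain i where i: "i < 4" and univ: "\<And>j. j < 4 \<Longrightarrow> i = j \<or> code_adj es i j"
      unfolding has_universal_def by auto
    have "w i \<in> core" using i w by (auto simp: bij_betw_def)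
    then obtain v where v: "v \<in> core" "w i \<noteq> v" "\<not> adj (w i) v" by (rule core_nonadjacent)
    then obtain j where "j < 4" "v = w j" using w by (auto simp: bij_betw_def)
    thus False using v univ[of j] adj[of i j] i by auto
  qed
  moreover have "es \<in> set (subseqs (pairs 4))"
    unfolding es_def set_subseqs_eq by simp
  ultimately obtain fs p where fs: "fs \<in> set codes4" and p: "p \<in> set (arrangements [0..<4])"
    and same: "same_code 4 es fs p"
    using codes4_exhaustive by blast
  note bij = bij_betw_arrangement[OF p]
  have "cone_over 4 fs G"
  proof (rule cone_over_core[of "\<lambda>i. w (p ! i)"])
    show "bij_betw (\<lambda>i. w (p ! i)) {..<4} core"
      using bij_betw_trans[OF bij w] by (simp add: o_def)
    fix i j :: nat assume ij: "i < j" "j < 4"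
    have "p ! i < 4" "p ! j < 4" "p ! i \<noteq> p ! j"
      using bij ij by (auto simp: bij_betw_def inj_on_def)
    thus "adj (w (p ! i)) (w (p ! j)) \<longleftrightarrow> code_adj fs i j"
      using same ij by (auto simp: adj same_code_def set_pairs)
  qed
  thus ?thesis using fs by blast
qed

lemma cone_over_5:
  assumes card: "card core = 5" and sing: "\<not> nonsingular_on core seidel"
  shows "\<exists>es\<in>set codes5. cone_over 5 es G"
proof -
  obtain w :: "nat \<Rightarrow> 'a" where w: "bij_betw w {..<5} core"
    using finite_same_card_bij[of "{..<5::nat}" core] finite_core card by auto
  obtain x where eq: "\<And>u. u \<in> core \<Longrightarrow> (\<Sum>v\<in>core. seidel u v * x v) = 0" and nz: "\<exists>u\<in>core. x u \<noteq> 0"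
    using sing unfolding nonsingular_on_def by blast
  define r where "r i j \<longleftrightarrow> adj (w i) (w j)" for i j
  have rsym: "r i j \<longleftrightarrow> r j i" for i j unfolding r_def by (rule adj_sym)
  \<comment> \<open>Adjacency after switching with respect to the neighbourhood of
    \<open>w 0\<close>, which makes \<open>w 0\<close> isolated.\<close>
  define t where "t i j \<longleftrightarrow> r i j \<noteq> (r 0 i \<noteq> r 0 j)" for i j
  have tsym: "t i j \<longleftrightarrow> t j i" for i j using rsym[of i j] by (auto simp: t_def)
  have eqs: "(\<Sum>j<5. seidel (w i) (w j) * x (w j)) = 0" if "i < 5" for i
    using sum.reindex_bij_betw[OF w, of "\<lambda>v. seidel (w i) v * x v"] eq that w
    by (auto simp: bij_betw_def)
  have row:
    "sg (r 0 1) * x (w 1) + sg (r 0 2) * x (w 2) + sg (r 0 3) * x (w 3) + sg (r 0 4) * x (w 4) = 0"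
    "sg (r 0 1) * x (w 0) + sg (r 1 2) * x (w 2) + sg (r 1 3) * x (w 3) + sg (r 1 4) * x (w 4) = 0"
    "sg (r 0 2) * x (w 0) + sg (r 1 2) * x (w 1) + sg (r 2 3) * x (w 3) + sg (r 2 4) * x (w 4) = 0"
    "sg (r 0 3) * x (w 0) + sg (r 1 3) * x (w 1) + sg (r 2 3) * x (w 2) + sg (r 3 4) * x (w 4) = 0"
    "sg (r 0 4) * x (w 0) + sg (r 1 4) * x (w 1) + sg (r 2 4) * x (w 2) + sg (r 3 4) * x (w 3) = 0"
    using eqs[of 0] eqs[of 1] eqs[of 2] eqs[of 3] eqs[of 4]
    unfolding r_def sum_lessThan_5
    by (simp_all add: seidel_index_min[OF bij_betw_imp_inj_on[OF w]] del: One_nat_def split del: if_split)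
  have "four_path (t 1 2) (t 1 3) (t 1 4) (t 2 3) (t 2 4) (t 3 4)"
    unfolding t_def
  proof (rule seidel_5[of _ "x (w 1)" _ "x (w 2)" _ "x (w 3)" _ "x (w 4)" "x (w 0)"])
    have "\<exists>k<5. x (w k) \<noteq> 0"
      using nz unfolding bij_betw_imp_surj_on[OF w, symmetric] by blast
    then obtain k where k: "k < 5" "x (w k) \<noteq> 0" by blast
    moreover have "k = 0 \<or> k = 1 \<or> k = 2 \<or> k = 3 \<or> k = 4" using k by auto
    ultimately show "x (w 0) \<noteq> 0 \<or> x (w 1) \<noteq> 0 \<or> x (w 2) \<noteq> 0 \<or> x (w 3) \<noteq> 0 \<or> x (w 4) \<noteq> 0"
      by auto
  qed (fact row)+
  note path4 = this
  define ps :: "(nat \<times> nat) list" where "ps = [(1, 2), (1, 3), (1, 4), (2, 3), (2, 4), (3, 4)]"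
  define es where "es = filter (\<lambda>(i, j). t i j) ps"
  have t_es: "code_adj es i j \<longleftrightarrow> t i j" if "i \<in> {1, 2, 3, 4}" "j \<in> {1, 2, 3, 4}" "i \<noteq> j" for i j
  proof -
    have lt: "code_adj es i j \<longleftrightarrow> t i j" if "(i, j) \<in> set ps" for i j
    proof -
      have lt: "a < b" if "(a, b) \<in> set ps" for a b using that unfolding ps_def by auto
      have "(j, i) \<notin> set ps" using lt[of i j] lt[of j i] that by force
      thus ?thesis using that by (simp add: code_adj_def es_def)
    qed
    have "(i, j) \<in> set ps \<or> (j, i) \<in> set ps" using that unfolding ps_def by auto
    thus ?thesis using lt[of i j] lt[of j i] tsym[of i j] by (auto simp: code_adj_def)
  qed
  have mem: "es \<in> set (subseqs ps)" unfolding es_def set_subseqs_eq by simp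
  have "four_path (code_adj es 1 2) (code_adj es 1 3) (code_adj es 1 4)
      (code_adj es 2 3) (code_adj es 2 4) (code_adj es 3 4)"
    using path4 by (simp add: t_es)
  with bspec[OF four_path_arrangement mem[unfolded ps_def]]
  have "\<exists>p\<in>set (arrangements [1, 2, 3, 4]).
      \<forall>(i, j)\<in>set (pairs 4). code_adj es (p ! i) (p ! j) \<longleftrightarrow> i + 1 = j"
    by (rule mp)
  then obtain p where p: "p \<in> set (arrangements [1, 2, 3, 4])"
    and path: "\<forall>(i, j)\<in>set (pairs 4). code_adj es (p ! i) (p ! j) \<longleftrightarrow> i + 1 = j"
    by blast
  have mp: "mset p = mset [1, 2, 3, 4]" using mset_arrangements[OF p] .
  have len: "length p = 4" using arg_cong[OF mp, of size] by simp
  have dist: "distinct p" using mset_eq_imp_distinct_iff[OF mp] by simp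
  have setp: "set p = {1, 2, 3, 4}" using arg_cong[OF mp, of set_mset] by simp
  \<comment> \<open>Vertex 0 comes first and then the path, so that path positions 0 to 3 become the
    vertices 1 to 4 of \<open>path_switch\<close>.\<close>
  define q where "q = 0 # p"
  have q: "length q = 5" "distinct q" "set q = {..<5}"
    using len dist by (auto simp: q_def setp)
  have bijq: "bij_betw ((!) q) {..<5} {..<5}" by (rule bij_betw_nth) (simp_all add: q)
  define w' where "w' i = w (q ! i)" for i
  have w': "bij_betw w' {..<5} core"
    using bij_betw_trans[OF bijq w] by (simp add: w'_def[abs_def] o_def)
  \<comment> \<open>Switching is an involution: switching the path back with respect to the
    neighbours of vertex 0 recovers the adjacency of \<open>G\<close>. Entry k - 1 belongs to vertex
    k.\<close>
  define b where "b = map (\<lambda>i. r 0 (p ! i)) [0..<4]"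
  have b_nth: "b ! (k - 1) \<longleftrightarrow> r 0 (p ! (k - 1))" if "0 < k" "k < 5" for k
  proof -
    have "k - 1 < 4" using that by linarith
    thus ?thesis by (simp add: b_def)
  qed
  have sw: "path_switch b i j \<longleftrightarrow> adj (w' i) (w' j)" if ij: "i < 5" "j < 5" "i \<noteq> j" for i j
  proof -
    have lt: "path_switch b i j \<longleftrightarrow> adj (w' i) (w' j)" if ij: "i < j" "j < 5" for i j
    proof (cases "i = 0")
      case True
      thus ?thesis using ij b_nth[of j] by (simp add: path_switch_def w'_def q_def r_def nth_Cons')
    next
      case False
      have m: "p ! (i - 1) \<in> {1, 2, 3, 4}" "p ! (j - 1) \<in> {1, 2, 3, 4}"
        using setp nth_mem[of "i - 1" p] nth_mem[of "j - 1" p] len ij by auto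
      have idx: "i - 1 < j - 1" "j - 1 < 4" using ij False by linarith+
      have "p ! (i - 1) \<noteq> p ! (j - 1)"
        using dist len ij False by (simp add: nth_eq_iff_index_eq)
      hence "t (p ! (i - 1)) (p ! (j - 1)) \<longleftrightarrow> (i - 1) + 1 = j - 1"
        using t_es[OF m] bspec[OF path, of "(i - 1, j - 1)"] idx by (simp add: set_pairs)
      moreover have "adj (w' i) (w' j) \<longleftrightarrow> r (p ! (i - 1)) (p ! (j - 1))"
        using ij False by (simp add: w'_def q_def r_def nth_Cons')
      moreover have "b ! (i - 1) \<longleftrightarrow> r 0 (p ! (i - 1))" "b ! (j - 1) \<longleftrightarrow> r 0 (p ! (j - 1))"
        using b_nth[of i] b_nth[of j] ij False by auto
      moreover have "(i - 1) + 1 = j - 1 \<longleftrightarrow> i + 1 = j \<or> j + 1 = i" using ij False by linarith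
      ultimately show ?thesis
        using ij False unfolding path_switch_def t_def by auto
    qed
    have "path_switch b i j \<longleftrightarrow> path_switch b j i" using that by (auto simp: path_switch_def)
    thus ?thesis using lt[of i j] lt[of j i] ij adj_sym[of "w' i" "w' j"] by (cases i j rule: linorder_cases) auto
  qed
  have "b \<in> set (List.n_lists 4 [False, True])" by (auto simp: set_n_lists b_def)
  moreover have "\<not> (\<exists>i\<in>set [0..<5]. \<forall>j\<in>set [0..<5]. i = j \<or> path_switch b i j)"
  proof
    assume "\<exists>i\<in>set [0..<5]. \<forall>j\<in>set [0..<5]. i = j \<or> path_switch b i j"
    then obtain i where i: "i < 5" and univ: "\<And>j. j < 5 \<Longrightarrow> i = j \<or> path_switch b i j" by auto
    have "w' i \<in> core" using i w' by (auto simp: bij_betw_def)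
    then obtain v where v: "v \<in> core" "w' i \<noteq> v" "\<not> adj (w' i) v" by (rule core_nonadjacent)
    then obtain j where "j < 5" "v = w' j" using w' by (auto simp: bij_betw_def)
    thus False using v univ[of j] sw[of i j] i by auto
  qed
  ultimately obtain fs p' where fs: "fs \<in> set codes5" and p': "p' \<in> set (arrangements [0..<5])"
    and same: "\<forall>(i, j)\<in>set (pairs 5). path_switch b (p' ! i) (p' ! j) \<longleftrightarrow> code_adj fs i j"
    using codes5_exhaustive by blast
  note bij = bij_betw_arrangement[OF p']
  have "cone_over 5 fs G"
  proof (rule cone_over_core[of "\<lambda>i. w' (p' ! i)"])
    show "bij_betw (\<lambda>i. w' (p' ! i)) {..<5} core"
      using bij_betw_trans[OF bij w'] by (simp add: o_def)
    fix i j :: nat assume ij: "i < j" "j < 5"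
    have "p' ! i < 5" "p' ! j < 5" "p' ! i \<noteq> p' ! j"
      using bij ij by (auto simp: bij_betw_def inj_on_def)
    thus "adj (w' (p' ! i)) (w' (p' ! j)) \<longleftrightarrow> code_adj fs i j"
      using same ij sw by (auto simp: set_pairs)
  qed
  thus ?thesis using fs by blast
qed

text \<open>The labelled vertices are exactly the core: each has a nonneighbour among them because
  the code has no universal vertex, and the remaining vertices are universal. This fixes h as the
  size of the core.\<close>

lemma cone_overE:
  assumes "cone_over h es G" and proper: "proper_code h es"
  obtains w where "bij_betw w {..<h} core"
    "\<And>i j. i < h \<Longrightarrow> j < h \<Longrightarrow> adj (w i) (w j) \<longleftrightarrow> code_adj es i j"
proof -
  obtain w where inj: "inj_on w {..<h}" and sub: "w ` {..<h} \<subseteq> V"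
    and adj: "\<And>i j. i < j \<Longrightarrow> j < h \<Longrightarrow> adj (w i) (w j) \<longleftrightarrow> code_adj es i j"
    and univ: "\<And>u v. u \<in> V - w ` {..<h} \<Longrightarrow> v \<in> V \<Longrightarrow> u \<noteq> v \<Longrightarrow> adj u v"
    using assms(1) unfolding cone_over_def by metis
  have irrefl: "\<not> code_adj es i i" for i
    using proper by (auto simp: proper_code_def code_adj_def)
  have adj': "adj (w i) (w j) \<longleftrightarrow> code_adj es i j" if "i < h" "j < h" for i j
    using adj[of i j] adj[of j i] that irrefl adj_irrefl adj_sym[of "w i" "w j"]
    by (cases i j rule: linorder_cases) (auto simp: code_adj_def)
  have "w i \<in> core" if i: "i < h" for i
  proof -
    have "\<exists>j\<in>{0..<h}. i \<noteq> j \<and> \<not> code_adj es i j"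
      using proper i by (auto simp: proper_code_def has_universal_def)
    then obtain j where "j < h" "i \<noteq> j" "\<not> code_adj es i j" by auto
    thus ?thesis using adj'[of i j] i sub inj unfolding core_def by (auto simp: inj_on_def)
  qed
  moreover have "core \<subseteq> w ` {..<h}" using univ by (auto simp: core_def)
  ultimately have "bij_betw w {..<h} core" using inj by (auto simp: bij_betw_def)
  thus ?thesis using that adj' by blast
qed

theorem multiplicity_iff_cone:
  assumes n: "card V \<ge> 16"
  shows "count E.spec (- 1) = card V - 5 \<longleftrightarrow>
    (\<exists>es\<in>set codes4. cone_over 4 es G) \<or> (\<exists>es\<in>set codes5. cone_over 5 es G)"
proof
  assume m: "count E.spec (- 1) = card V - 5"
  obtain c where c: "c \<in> V - core"
  proof (rule ccontr)
    assume "\<not> thesis"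
    hence "V \<subseteq> core" using that by blast
    hence "\<And>v. v \<in> V \<Longrightarrow> ecc v \<ge> 2" using ecc_core_ge by blast
    thus False using no_universal_vertex_bound m n by simp
  qed
  have two: "card V \<ge> 2" using n by simp
  \<comment> \<open>The rank of \<open>N\<close> is 5 here, and it is at least
    \<open>card core\<close> and at most \<open>card core + 1\<close>.\<close>
  have "card core = 4 \<or> card core = 5"
    using count_ge_core[OF c two] count_le_core[OF c two] m n by linarith
  \<comment> \<open>A nonsingular Seidel matrix of order 5 would raise the rank of \<open>N\<close>
    to 6.\<close>
  moreover have "\<not> nonsingular_on core seidel" if "card core = 5"
    using count_le_core_nonsingular[OF c two] m n that by linarith
  ultimately show "(\<exists>es\<in>set codes4. cone_over 4 es G) \<or> (\<exists>es\<in>set codes5. cone_over 5 es G)"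
    using cone_over_4 cone_over_5 by blast
next
  have two: "card V \<ge> 2" using n by simp
  have ex: "\<exists>c. c \<in> V - core" if "card core < 16"
  proof -
    have "V \<noteq> core" using that n by auto
    thus ?thesis using core_subset by blast
  qed
  assume "(\<exists>es\<in>set codes4. cone_over 4 es G) \<or> (\<exists>es\<in>set codes5. cone_over 5 es G)"
  then consider es where "es \<in> set codes4" "cone_over 4 es G"
    | es where "es \<in> set codes5" "cone_over 5 es G" by blast
  thus "count E.spec (- 1) = card V - 5"
  proof cases
    case 1
    have proper: "proper_code 4 es" using 1(1) proper_codes by blast
    obtain w :: "nat \<Rightarrow> 'a" where w: "bij_betw w {..<4} core"
      by (rule cone_overE[OF 1(2) proper])
    have card: "card core = 4" using bij_betw_same_card[OF w] by simp
    then obtain c where c: "c \<in> V - core" using ex by auto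
    show ?thesis
      using count_ge_core[OF c two] count_le_core_nonsingular[OF c two seidel_nonsingular_4[OF card]] card
      by simp
  next
    case 2
    have proper: "proper_code 5 es" using 2(1) proper_codes by blast
    obtain w :: "nat \<Rightarrow> 'a" where w: "bij_betw w {..<5} core"
      and adj: "\<And>i j. i < 5 \<Longrightarrow> j < 5 \<Longrightarrow> adj (w i) (w j) \<longleftrightarrow> code_adj es i j"
      by (rule cone_overE[OF 2(2) proper]) blast
    have card: "card core = 5" using bij_betw_same_card[OF w] by simp
    then obtain c where c: "c \<in> V - core" using ex by auto
    obtain ys :: "real list" where
      ys: "\<And>i. i < 5 \<Longrightarrow> (\<Sum>j<5. (if i = j then 0 else sg (code_adj es i j)) * ys ! j) = 0"
      and nz: "(\<Sum>j<5. ys ! j) \<noteq> 0"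
      using codes5_kernel[OF 2(1)] by blast
    define y where "y v = ys ! the_inv_into {..<5} w v" for v
    have yw: "y (w j) = ys ! j" if "j < 5" for j
      unfolding y_def using that w by (subst the_inv_into_f_f) (auto simp: bij_betw_def)
    have "card V \<le> count E.spec (- 1) + card core"
    proof (rule count_ge_core_singular[OF c two])
      fix u assume "u \<in> core"
      then obtain i where i: "i < 5" "u = w i" using w by (auto simp: bij_betw_def)
      have "(\<Sum>v\<in>core. seidel u v * y v) = (\<Sum>j<5. seidel u (w j) * y (w j))"
        by (rule sum.reindex_bij_betw[OF w, symmetric])
      also have "\<dots> = (\<Sum>j<5. (if i = j then 0 else sg (code_adj es i j)) * ys ! j)"
        using i by (intro sum.cong) (auto simp: seidel_index[OF bij_betw_imp_inj_on[OF w]] adj yw)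
      finally show "(\<Sum>v\<in>core. seidel u v * y v) = 0" using ys i by simp
    next
      have "(\<Sum>v\<in>core. y v) = (\<Sum>j<5. y (w j))" by (rule sum.reindex_bij_betw[OF w, symmetric])
      thus "(\<Sum>v\<in>core. y v) \<noteq> 0" using nz by (simp add: yw)
    qed
    thus ?thesis using count_le_core[OF c two] card by simp
  qed
qed

end

section \<open>Cospectral cones\<close>

definition codes :: "(nat \<times> (nat \<times> nat) list) list" where
  "codes = map (Pair 4) codes4 @ map (Pair 5) codes5"

lemma proper_code_codes: "(h, es) \<in> set codes \<Longrightarrow> proper_code h es"
  using proper_codes by (auto simp: codes_def)

definition seidel_code :: "(nat \<times> nat) list \<Rightarrow> nat \<Rightarrow> nat \<Rightarrow> int" where
  "seidel_code es i j = (if i = j then 0 else if code_adj es i j then - 1 else 1)"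

definition code_sum :: "nat \<Rightarrow> (nat \<times> nat) list \<Rightarrow> int" where
  "code_sum h es = (\<Sum>i<h. \<Sum>j<h. seidel_code es i j)"

definition code_squares :: "nat \<Rightarrow> (nat \<times> nat) list \<Rightarrow> int" where
  "code_squares h es = (\<Sum>i<h. \<Sum>j<h. seidel_code es i j * seidel_code es j i)"

text \<open>The part of tr (J + S)^3 that does not depend on the order of J: three times the sum of
  the entries of S^2, plus tr S^3.\<close>

definition code_cubes :: "nat \<Rightarrow> (nat \<times> nat) list \<Rightarrow> int" where
  "code_cubes h es = 3 * (\<Sum>i<h. \<Sum>j<h. \<Sum>k<h. seidel_code es i j * seidel_code es j k) +
    (\<Sum>i<h. \<Sum>j<h. \<Sum>k<h. seidel_code es i j * seidel_code es j k * seidel_code es k i)"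

definition invariants :: "nat \<times> (nat \<times> nat) list \<Rightarrow> int \<times> int \<times> int" where
  "invariants c = (case c of (h, es) \<Rightarrow>
    (code_sum h es, 2 * code_sum h es + code_squares h es, code_cubes h es))"

lemma invariants_codes:
  "map invariants codes = [(12, 36, 132), (8, 28, 60), (4, 20, 36), (4, 20, - 12), (0, 12, 12), (0, 12, 12), (- 4, 4, 36), (0, 20, 0), (8, 36, 72), (0, 20, 48)]"
  by code_simp


text \<open>
  For the invariants \<open>(s, q, t)\<close> of \<open>F\<close> and a cone over \<open>F\<close> of order \<open>n\<close>, the eigenvalues of \<open>N\<close> have
  second power sum \<open>n\<^sup>2 + q\<close> and third power sum \<open>n\<^sup>3 + 3 n s + t\<close>; the constant 48 is \<open>3 n\<close> at \<open>n = 16\<close>.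
\<close>

definition separated :: "int \<times> int \<times> int \<Rightarrow> int \<times> int \<times> int \<Rightarrow> bool" where
  "separated x y = (case (x, y) of ((s, q, t), (s', q', t')) \<Rightarrow>
    q \<noteq> q' \<or> (if s = s' then t \<noteq> t' else \<bar>t - t'\<bar> < 48 * \<bar>s - s'\<bar>))"

lemma codes_separated:
  assumes "c \<in> set codes" "d \<in> set codes" "c \<noteq> d"
  shows "separated (invariants c) (invariants d) \<or>
    {c, d} = {(4, [(0, 1), (1, 2), (2, 3)]), (4, [(0, 1), (1, 2), (0, 2)])}"
proof -
  have len: "length codes = 10" by (simp add: codes_def codes4_def codes5_def)
  obtain i j where ij: "i < 10" "j < 10" "c = codes ! i" "d = codes ! j"
    using assms(1,2) unfolding in_set_conv_nth len by blast
  \<comment> \<open>Positions 4 and 5, counted from 0, are P4 and K3 \<union> K1, whose triples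
    coincide.\<close>
  have "\<forall>i\<in>set [0..<10]. \<forall>j\<in>set [0..<10]. i = j \<or>
      separated (map invariants codes ! i) (map invariants codes ! j) \<or> {i, j} = {4, 5}"
    unfolding invariants_codes by code_simp
  note table = this
  have "i \<in> set [0..<10]" "j \<in> set [0..<10]" using ij by simp_all
  from bspec[OF bspec[OF table this(1)] this(2)]
  have "separated (invariants c) (invariants d) \<or> {i, j} = {4, 5}"
    using assms(3) ij by (metis len nth_map)
  moreover have "{c, d} = {(4, [(0, 1), (1, 2), (2, 3)]), (4, [(0, 1), (1, 2), (0, 2)])}" if "{i, j} = {4, 5}"
    using that ij by (auto simp: codes_def codes4_def codes5_def doubleton_eq_iff)
  ultimately show ?thesis by blast
qed

text \<open>Equality with s different from s' would give |t - t'| = 3 n |s - s'|, which is at least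
  48 |s - s'|.\<close>

lemma separated_polynomials:
  fixes n :: nat
  assumes n: "n \<ge> 16" and sep: "separated (s, q, t) (s', q', t')" and q: "q = q'"
  shows "3 * int n * s + t \<noteq> 3 * int n * s' + t'"
proof
  assume eq: "3 * int n * s + t = 3 * int n * s' + t'"
  hence t: "t' - t = 3 * int n * (s - s')" by (simp add: algebra_simps)
  have "s \<noteq> s'" "\<bar>t - t'\<bar> < 48 * \<bar>s - s'\<bar>" using sep q eq by (auto simp: separated_def split: if_splits)
  moreover have "\<bar>t - t'\<bar> = 3 * int n * \<bar>s - s'\<bar>"
    using t by (simp add: abs_mult abs_minus_commute[of t])
  moreover have "48 * \<bar>s - s'\<bar> \<le> 3 * int n * \<bar>s - s'\<bar>" using n by (intro mult_right_mono) auto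
  ultimately show False by linarith
qed

text \<open>Cyclic invariance of the trace; it identifies the three mixed terms of each degree in
  the expansion of the cube.\<close>

lemma sum_rotate:
  "(\<Sum>u\<in>A. \<Sum>v\<in>A. \<Sum>w\<in>A. f v w u) = (\<Sum>u\<in>A. \<Sum>v\<in>A. \<Sum>w\<in>A. f u v w)"
proof -
  have "(\<Sum>u\<in>A. \<Sum>v\<in>A. \<Sum>w\<in>A. f v w u) = (\<Sum>v\<in>A. \<Sum>u\<in>A. \<Sum>w\<in>A. f v w u)"
    by (rule sum.swap)
  also have "\<dots> = (\<Sum>v\<in>A. \<Sum>w\<in>A. \<Sum>u\<in>A. f v w u)"
    by (intro sum.cong refl sum.swap)
  finally show ?thesis .
qed

context finite_connected_graph
begin

lemma cone_nonempty_universal: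
  assumes "bij_betw w {..<h} core" "h < card V"
  obtains c where "c \<in> V - core"
proof -
  have "card core = h" using bij_betw_same_card[OF assms(1)] by simp
  hence "V \<noteq> core" using assms(2) by auto
  thus ?thesis using core_subset that by blast
qed

text \<open>The traces of (J + D)^2 and (J + D)^3 are expanded, where \<open>D\<close> is the Seidel
  matrix of the core extended by zeros. In the cube each term linear in \<open>D\<close> leaves one
  vertex free and so carries a factor n, while the quadratic and cubic terms depend on the code
  only.\<close>

lemma cone_power_sums:
  assumes cone: "cone_over h es G" and proper: "proper_code h es" and n: "h < card V" "2 \<le> card V"
  defines "n \<equiv> int (card V)"
  shows "(\<Sum>x\<in>#E.spec. (x + 1)\<^sup>2) = of_int (n\<^sup>2 + (2 * code_sum h es + code_squares h es))"
    and "(\<Sum>x\<in>#E.spec. (x + 1) ^ 3) = of_int (n ^ 3 + 3 * n * code_sum h es + code_cubes h es)"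
proof -
  obtain w :: "nat \<Rightarrow> 'a" where w: "bij_betw w {..<h} core"
    and adj: "\<And>i j. i < h \<Longrightarrow> j < h \<Longrightarrow> adj (w i) (w j) \<longleftrightarrow> code_adj es i j"
    by (rule cone_overE[OF cone proper]) blast
  obtain c where c: "c \<in> V - core" by (rule cone_nonempty_universal[OF w n(1)])
  define D where "D u v = (if u \<in> core \<and> v \<in> core then seidel u v else 0)" for u v
  have N: "N u v = 1 + D u v" if "u \<in> V" "v \<in> V" for u v
    using N_core[OF c n(2)] N_universal[OF c n(2) that] by (auto simp: D_def)
  have index: "D (w i) (w j) = of_int (seidel_code es i j)" if "i < h" "j < h" for i j
    using that w seidel_index[OF bij_betw_imp_inj_on[OF w] that]
    by (auto simp: D_def seidel_code_def adj bij_betw_def)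
  have reindex: "(\<Sum>v\<in>V. f v) = (\<Sum>j<h. f (w j))" if "\<And>v. v \<notin> core \<Longrightarrow> f v = 0" for f :: "'a \<Rightarrow> real"
  proof -
    have "(\<Sum>v\<in>V. f v) = (\<Sum>v\<in>core. f v)"
      using that core_subset pair_finite_verts by (intro sum.mono_neutral_right) auto
    also have "\<dots> = (\<Sum>j<h. f (w j))" by (rule sum.reindex_bij_betw[OF w, symmetric])
    finally show ?thesis .
  qed
  have D0: "D u v = 0" if "u \<notin> core \<or> v \<notin> core" for u v using that by (auto simp: D_def)
  have S1: "(\<Sum>u\<in>V. \<Sum>v\<in>V. D u v) = of_int (code_sum h es)"
    by (simp add: reindex D0 index code_sum_def)
  have S2: "(\<Sum>u\<in>V. \<Sum>v\<in>V. D u v * D v u) = of_int (code_squares h es)"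
    by (simp add: reindex D0 index code_squares_def)
  have S3: "3 * (\<Sum>u\<in>V. \<Sum>v\<in>V. \<Sum>w\<in>V. D u v * D v w) + (\<Sum>u\<in>V. \<Sum>v\<in>V. \<Sum>w\<in>V. D u v * D v w * D w u)
      = of_int (code_cubes h es)"
    by (simp add: reindex D0 index code_cubes_def)
  have swap: "(\<Sum>u\<in>V. \<Sum>v\<in>V. D v u) = (\<Sum>u\<in>V. \<Sum>v\<in>V. D u v)" by (rule sum.swap)
  have "(\<Sum>x\<in>#E.spec. (x + 1)\<^sup>2) = (\<Sum>u\<in>V. \<Sum>v\<in>V. N u v * N v u)"
    using E.spec_power_sums(1)[of "- 1"] by simp
  also have "\<dots> = (\<Sum>u\<in>V. \<Sum>v\<in>V. 1 + D u v + D v u + D u v * D v u)"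
    by (intro sum.cong refl) (simp add: N algebra_simps)
  also have "\<dots> = of_int (n\<^sup>2 + (2 * code_sum h es + code_squares h es))"
    by (simp add: sum.distrib swap S1 S2 n_def power2_eq_square)
  finally show "(\<Sum>x\<in>#E.spec. (x + 1)\<^sup>2) = of_int (n\<^sup>2 + (2 * code_sum h es + code_squares h es))" .
  have r1: "(\<Sum>u\<in>V. \<Sum>v\<in>V. \<Sum>w\<in>V. D v w) = real (card V) * of_int (code_sum h es)"
    by (simp add: S1)
  have r2: "(\<Sum>u\<in>V. \<Sum>v\<in>V. \<Sum>w\<in>V. D u v) = real (card V) * of_int (code_sum h es)"
    using sum_rotate[of "\<lambda>u v w. D u v" V] r1 by simp
  have r3: "(\<Sum>u\<in>V. \<Sum>v\<in>V. \<Sum>w\<in>V. D w u) = real (card V) * of_int (code_sum h es)"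
    using sum_rotate[of "\<lambda>u v w. D v w" V] sum_rotate[of "\<lambda>u v w. D w u" V] r1 r2 by simp
  have p1: "(\<Sum>u\<in>V. \<Sum>v\<in>V. \<Sum>w\<in>V. D v w * D w u) = (\<Sum>u\<in>V. \<Sum>v\<in>V. \<Sum>w\<in>V. D u v * D v w)"
    by (rule sum_rotate[of "\<lambda>u v w. D u v * D v w"])
  have p2: "(\<Sum>u\<in>V. \<Sum>v\<in>V. \<Sum>w\<in>V. D w u * D u v) = (\<Sum>u\<in>V. \<Sum>v\<in>V. \<Sum>w\<in>V. D u v * D v w)"
    using sum_rotate[of "\<lambda>u v w. D w u * D u v" V] by simp
  have "(\<Sum>x\<in>#E.spec. (x + 1) ^ 3) = (\<Sum>u\<in>V. \<Sum>v\<in>V. \<Sum>w\<in>V. N u v * N v w * N w u)"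
    using E.spec_power_sums(2)[of "- 1"] by simp
  also have "\<dots> = (\<Sum>u\<in>V. \<Sum>v\<in>V. \<Sum>w\<in>V. 1 + D u v + D v w + D w u +
      D u v * D v w + D v w * D w u + D w u * D u v + D u v * D v w * D w u)"
    by (intro sum.cong refl) (simp add: N algebra_simps)
  also have "\<dots> = real (card V) ^ 3 + 3 * (real (card V) * of_int (code_sum h es)) + of_int (code_cubes h es)"
    unfolding sum.distrib r1 r2 r3 p1 p2 S3[symmetric] by (simp add: power3_eq_cube)
  finally show "(\<Sum>x\<in>#E.spec. (x + 1) ^ 3) = of_int (n ^ 3 + 3 * n * code_sum h es + code_cubes h es)"
    by (simp add: n_def)
qed

text \<open>Two vertices of the triangle are adjacent twins with entry 0 between them, so their
  columns in the eccentricity matrix agree; \<open>x\<close> is the difference of their unit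
  vectors.\<close>

lemma cone_zero_eigenvalue:
  assumes cone: "cone_over 4 [(0, 1), (1, 2), (0, 2)] G" and n: "card V \<ge> 16"
  shows "0 \<in># E.spec"
proof -
  let ?es = "[(0, 1), (1, 2), (0, 2)] :: (nat \<times> nat) list"
  have proper: "proper_code 4 ?es" by (rule proper_code_codes) (simp add: codes_def codes4_def)
  obtain w :: "nat \<Rightarrow> 'a" where w: "bij_betw w {..<4} core"
    and adj: "\<And>i j. i < 4 \<Longrightarrow> j < 4 \<Longrightarrow> adj (w i) (w j) \<longleftrightarrow> code_adj ?es i j"
    by (rule cone_overE[OF cone proper]) blast
  obtain c where c: "c \<in> V - core" by (rule cone_nonempty_universal[OF w]) (use n in auto)
  have two: "2 \<le> card V" using n by simp
  have core: "core = {w 0, w 1, w 2, w 3}"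
    using bij_betw_imp_surj_on[OF w] by (auto simp: eval_nat_numeral lessThan_Suc)
  have dist: "w i = w j \<longleftrightarrow> i = j" if "i < 4" "j < 4" for i j
    using w that by (auto simp: bij_betw_def inj_on_def)
  have in_V: "w 0 \<in> V" "w 1 \<in> V" using core core_subset by auto
  define x :: "'a \<Rightarrow> real" where "x v = (if v = w 0 then 1 else 0) - (if v = w 1 then 1 else 0)" for v
  have a: "ecc_entry G u v = N u v - (if u = v then 1 else 0)" for u v by (simp add: shifted_def)
  have s: "seidel (w i) (w j) = (if i = j then 0 else sg (code_adj ?es i j))" if "i < 4" "j < 4" for i j
    using seidel_index[OF bij_betw_imp_inj_on[OF w] that] adj that by simp
  have "ecc_entry G u (w 0) = ecc_entry G u (w 1)" if u: "u \<in> V" for u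
  proof (cases "u \<in> core")
    case True
    then consider "u = w 0" | "u = w 1" | "u = w 2" | "u = w 3" using core by auto
    thus ?thesis
      by cases (simp_all add: a N_core[OF c two] core s dist code_adj_def)
  next
    case False
    thus ?thesis using N_universal[OF c two u] in_V core by (auto simp: a)
  qed
  hence "(\<Sum>v\<in>V. shifted 0 (ecc_entry G) u v * x v) = 0" if "u \<in> V" for u
    using that in_V pair_finite_verts
    by (simp add: shifted_def x_def right_diff_distrib sum_subtractf if_distrib[of "\<lambda>t. _ * t"] cong: if_cong)
  moreover have "x (w 0) \<noteq> 0" using dist[of 0 1] by (simp add: x_def)
  ultimately have "\<not> nonsingular_on V (shifted 0 (ecc_entry G))"
    unfolding nonsingular_on_def using in_V by blast
  thus ?thesis by (simp add: E.spec_iff_singular)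
qed

lemma cone_no_zero_eigenvalue:
  assumes cone: "cone_over 4 [(0, 1), (1, 2), (2, 3)] G" and n: "card V \<ge> 16"
  shows "0 \<notin># E.spec"
proof -
  let ?es = "[(0, 1), (1, 2), (2, 3)] :: (nat \<times> nat) list"
  have proper: "proper_code 4 ?es" by (rule proper_code_codes) (simp add: codes_def codes4_def)
  obtain w :: "nat \<Rightarrow> 'a" where w: "bij_betw w {..<4} core"
    and adj: "\<And>i j. i < 4 \<Longrightarrow> j < 4 \<Longrightarrow> adj (w i) (w j) \<longleftrightarrow> code_adj ?es i j"
    by (rule cone_overE[OF cone proper]) blast
  obtain c where c: "c \<in> V - core" by (rule cone_nonempty_universal[OF w]) (use n in auto)
  have two: "2 \<le> card V" using n by simp
  have core: "core = {w 0, w 1, w 2, w 3}"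
    using bij_betw_imp_surj_on[OF w] by (auto simp: eval_nat_numeral lessThan_Suc)
  have s: "seidel (w i) (w j) = (if i = j then 0 else sg (code_adj ?es i j))" if "i < 4" "j < 4" for i j
    using seidel_index[OF bij_betw_imp_inj_on[OF w] that] adj that by simp
  have "nonsingular_on V (shifted 0 (ecc_entry G))"
    unfolding nonsingular_on_def
  proof (intro allI impI)
    fix x assume eq: "\<forall>u\<in>V. (\<Sum>v\<in>V. shifted 0 (ecc_entry G) u v * x v) = 0"
    define t where "t = (\<Sum>v\<in>V. x v)"
    \<comment> \<open>Since \<open>N\<close> = A + I, a kernel vector of A satisfies N x =
      x.\<close>
    have row: "t + (if u \<in> core then \<Sum>v\<in>core. seidel u v * x v else 0) = x u" if u: "u \<in> V" for u
    proof -
      have "(\<Sum>v\<in>V. N u v * x v) = (\<Sum>v\<in>V. shifted 0 (ecc_entry G) u v * x v) + x u"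
        using u pair_finite_verts
        by (simp add: shifted_def left_diff_distrib sum_subtractf if_distrib[of "\<lambda>t. t * _"] cong: if_cong)
      thus ?thesis using eq u N_row[OF c two u, of x] by (simp add: t_def)
    qed
    have rowc: "t + (\<Sum>j<4. seidel (w i) (w j) * x (w j)) = x (w i)" if "i < 4" for i
    proof -
      have "w i \<in> core" using bij_betw_apply[OF w, of i] that by simp
      moreover from this have "w i \<in> V" using core_subset by blast
      ultimately show ?thesis
        using row[of "w i"] sum.reindex_bij_betw[OF w, of "\<lambda>v. seidel (w i) v * x v"] by simp
    qed
    have rows:
      "t - x (w 1) + x (w 2) + x (w 3) = x (w 0)" "t - x (w 0) - x (w 2) + x (w 3) = x (w 1)"
      "t + x (w 0) - x (w 1) - x (w 3) = x (w 2)" "t + x (w 0) + x (w 1) - x (w 2) = x (w 3)"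
      using rowc[of 0] rowc[of 1] rowc[of 2] rowc[of 3] by (simp_all add: sum_lessThan_4 s code_adj_def)
    have off: "x u = t" if "u \<in> V - core" for u using row[of u] that by simp
    have "t = (\<Sum>v\<in>V - core. x v) + (\<Sum>v\<in>core. x v)"
      unfolding t_def using core_subset pair_finite_verts by (rule sum.subset_diff)
    also have "(\<Sum>v\<in>V - core. x v) = real (card (V - core)) * t" using off by simp
    also have "(\<Sum>v\<in>core. x v) = x (w 0) + x (w 1) + x (w 2) + x (w 3)"
      using sum.reindex_bij_betw[OF w, of x] by (simp add: sum_lessThan_4)
    finally have total: "t = real (card (V - core)) * t + (x (w 0) + x (w 1) + x (w 2) + x (w 3))" .
    \<comment> \<open>The rows of the two ends of the path add up to 2 t = 0. With t = 0 the core
      rows still admit the multiples of (1, 0, 0, 1); the equation for the total removes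
      them.\<close>
    have "t = 0" using rows by linarith
    moreover from this have sum0: "x (w 0) + x (w 1) + x (w 2) + x (w 3) = 0" using total by simp
    ultimately have "x (w 0) = 0" "x (w 1) = 0" "x (w 2) = 0" "x (w 3) = 0" using rows sum0 by linarith+
    thus "\<forall>v\<in>V. x v = 0" using off \<open>t = 0\<close> core by auto
  qed
  thus ?thesis by (simp add: E.spec_iff_singular)
qed

end

section \<open>The extremal family\<close>

lemma parcs_join:
  fixes F :: "'c pair_pre_digraph"
  shows "(Inl i, Inl j) \<in> parcs (complete_graph k \<or>\<^sub>g F) \<longleftrightarrow> i < k \<and> j < k \<and> i \<noteq> j"
    and "(Inr x, Inr y) \<in> parcs (complete_graph k \<or>\<^sub>g F) \<longleftrightarrow> (x, y) \<in> parcs F"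
    and "(Inl i, Inr y) \<in> parcs (complete_graph k \<or>\<^sub>g F) \<longleftrightarrow> i < k \<and> y \<in> pverts F"
    and "(Inr x, Inl j) \<in> parcs (complete_graph k \<or>\<^sub>g F) \<longleftrightarrow> j < k \<and> x \<in> pverts F"
  by (auto simp: graph_join_def disjoint_union_def complete_graph_def)

lemma pverts_join: "pverts (complete_graph k \<or>\<^sub>g F) = {..<k} <+> pverts F"
  by (simp add: graph_join_def complete_graph_def)

lemma wf_join:
  assumes "pair_wf_digraph F"
  shows "pair_wf_digraph (complete_graph k \<or>\<^sub>g F)"
  using pair_wf_digraph.arc_fst_in_verts[OF assms] pair_wf_digraph.arc_snd_in_verts[OF assms]
  by unfold_locales (auto simp: graph_join_def disjoint_union_def complete_graph_def)

text \<open>The list \<open>xs\<close> matches code positions with the vertices of \<open>F\<close>,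
  which are numbers, pairs or elements of a sum type depending on the named graph.\<close>

definition represents :: "(nat \<times> nat) list \<Rightarrow> 'c list \<Rightarrow> 'c pair_pre_digraph \<Rightarrow> bool" where
  "represents es xs F \<longleftrightarrow> pair_wf_digraph F \<and> distinct xs \<and> set xs = pverts F \<and>
    (\<forall>i<length xs. \<forall>j<length xs. (xs ! i, xs ! j) \<in> parcs F \<longleftrightarrow> code_adj es i j)"

context finite_connected_graph
begin

lemma iso_join_iff_cone:
  fixes F :: "'c pair_pre_digraph"
  assumes F: "represents es xs F" and h: "length xs = h" "h \<le> card V" and proper: "proper_code h es"
  shows "G \<cong>\<^sub>g complete_graph (card V - h) \<or>\<^sub>g F \<longleftrightarrow> cone_over h es G"
proof -
  define k where "k = card V - h"
  let ?J = "complete_graph k \<or>\<^sub>g F"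
  have wfF: "pair_wf_digraph F" and xs: "distinct xs" "set xs = pverts F"
    and arcs: "\<And>i j. i < h \<Longrightarrow> j < h \<Longrightarrow> (xs ! i, xs ! j) \<in> parcs F \<longleftrightarrow> code_adj es i j"
    using F h by (auto simp: represents_def)
  have g: "bij_betw ((!) xs) {..<h} (pverts F)"
    by (rule bij_betw_nth) (use xs h in auto)
  have iso: "G \<cong>\<^sub>g ?J \<longleftrightarrow> (\<exists>f. bij_betw f V (pverts ?J) \<and>
      (\<forall>u\<in>V. \<forall>v\<in>V. adj u v \<longleftrightarrow> (f u, f v) \<in> parcs ?J))"
    by (rule graph_iso_iff[OF _ wf_join[OF wfF]]) unfold_locales
  have "G \<cong>\<^sub>g ?J \<longleftrightarrow> cone_over h es G"
  proof
    assume "G \<cong>\<^sub>g ?J"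
    then obtain f where f: "bij_betw f V (pverts ?J)"
      and adj: "\<And>u v. u \<in> V \<Longrightarrow> v \<in> V \<Longrightarrow> adj u v \<longleftrightarrow> (f u, f v) \<in> parcs ?J"
      unfolding iso by blast
    have gF: "xs ! i \<in> pverts F" if "i < h" for i using g that by (auto simp: bij_betw_def)
    have ex: "\<exists>v\<in>V. f v = Inr (xs ! i)" if "i < h" for i
    proof -
      have "Inr (xs ! i) \<in> f ` V"
        unfolding bij_betw_imp_surj_on[OF f] pverts_join using gF[OF that] by auto
      thus ?thesis by force
    qed
    define w where "w i = (SOME v. v \<in> V \<and> f v = Inr (xs ! i))" for i
    have w: "w i \<in> V" "f (w i) = Inr (xs ! i)" if "i < h" for i
      using someI_ex[of "\<lambda>v. v \<in> V \<and> f v = Inr (xs ! i)"] ex[OF that] unfolding w_def by blast+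
    show "cone_over h es G"
      unfolding cone_over_def
    proof (intro exI[of _ w] conjI allI impI ballI)
      show "inj_on w {..<h}"
      proof (rule inj_onI)
        fix i j assume ij: "i \<in> {..<h}" "j \<in> {..<h}" "w i = w j"
        hence "xs ! i = xs ! j" using w[of i] w[of j] by simp
        thus "i = j" using ij xs h by (simp add: nth_eq_iff_index_eq)
      qed
      show "w ` {..<h} \<subseteq> V" using w by auto
      show "adj (w i) (w j) \<longleftrightarrow> code_adj es i j" if "i < j" "j < h" for i j
        using adj[of "w i" "w j"] w[of i] w[of j] arcs[of i j] that by (simp add: parcs_join)
      fix u v assume u: "u \<in> V - w ` {..<h}" and v: "v \<in> V" and "u \<noteq> v"
      have fV: "f x \<in> {..<k} <+> pverts F" if "x \<in> V" for x
        using f that unfolding pverts_join bij_betw_def by blast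
      have "f u \<noteq> f v" using f u v \<open>u \<noteq> v\<close> by (auto simp: bij_betw_def dest: inj_onD)
      have "\<exists>i<k. f u = Inl i"
      proof (rule ccontr)
        assume "\<not> ?thesis"
        then obtain x where x: "x \<in> pverts F" "f u = Inr x" using fV[of u] u by auto
        then obtain i where i: "i < h" "x = xs ! i" using g by (auto simp: bij_betw_def)
        hence "f u = f (w i)" "w i \<in> V" using w[of i] x by auto
        hence "u = w i" using inj_onD[OF bij_betw_imp_inj_on[OF f]] u by blast
        thus False using u i by blast
      qed
      then obtain i where "i < k" "f u = Inl i" by blast
      thus "adj u v"
        using adj[of u v] u v fV[OF v] \<open>f u \<noteq> f v\<close> by (auto simp: parcs_join)
    qed
  next
    assume "cone_over h es G"
    then obtain w where inj: "inj_on w {..<h}" and sub: "w ` {..<h} \<subseteq> V"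
      and lt: "\<And>i j. i < j \<Longrightarrow> j < h \<Longrightarrow> adj (w i) (w j) \<longleftrightarrow> code_adj es i j"
      and univ: "\<And>u v. u \<in> V - w ` {..<h} \<Longrightarrow> v \<in> V \<Longrightarrow> u \<noteq> v \<Longrightarrow> adj u v"
      unfolding cone_over_def by metis
    let ?W = "w ` {..<h}"
    have irrefl: "\<not> code_adj es i i" for i
      using proper by (auto simp: proper_code_def code_adj_def)
    have adj: "adj (w i) (w j) \<longleftrightarrow> code_adj es i j" if "i < h" "j < h" for i j
      using lt[of i j] lt[of j i] that irrefl adj_irrefl adj_sym[of "w i" "w j"]
      by (cases i j rule: linorder_cases) (auto simp: code_adj_def)
    have "card (V - ?W) = k"
      using sub inj pair_finite_verts by (simp add: card_Diff_subset card_image k_def finite_subset)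
    \<comment> \<open>Any numbering of the remaining vertices will do, since they are mutually
      adjacent.\<close>
    then obtain e where e: "bij_betw e (V - ?W) {..<k}"
      using finite_same_card_bij[of "V - ?W" "{..<k}"] pair_finite_verts by auto
    define r where "r = the_inv_into {..<h} w"
    have r: "r (w i) = i" if "i < h" for i
      unfolding r_def using inj that by (simp add: the_inv_into_f_f)
    have br: "bij_betw r ?W {..<h}"
      unfolding r_def using inj by (simp add: bij_betw_the_inv_into inj_on_imp_bij_betw)
    define f :: "'a \<Rightarrow> nat + 'c" where "f v = (if v \<in> ?W then Inr (xs ! r v) else Inl (e v))" for v
    have "bij_betw (\<lambda>v. Inl (e v) :: nat + 'c) (V - ?W) (Inl ` {..<k})"
      using bij_betw_trans[OF e, of Inl "Inl ` {..<k}"] by (simp add: o_def bij_betw_def)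
    hence b1: "bij_betw f (V - ?W) (Inl ` {..<k})"
      by (rule iffD1[OF bij_betw_cong, rotated]) (simp add: f_def)
    have "bij_betw (\<lambda>v. Inr (xs ! r v) :: nat + 'c) ?W (Inr ` pverts F)"
      using bij_betw_trans[OF bij_betw_trans[OF br g], of Inr "Inr ` pverts F"]
      by (simp add: o_def bij_betw_def)
    hence b2: "bij_betw f ?W (Inr ` pverts F)"
      by (rule iffD1[OF bij_betw_cong, rotated]) (simp add: f_def)
    have "bij_betw f ((V - ?W) \<union> ?W) (Inl ` {..<k} \<union> Inr ` pverts F)"
      by (rule bij_betw_combine[OF b1 b2]) auto
    hence f: "bij_betw f V (pverts ?J)"
      using sub by (simp add: pverts_join Plus_def Un_absorb2)
    have gF: "xs ! i \<in> pverts F" if "i < h" for i using g that by (auto simp: bij_betw_def)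
    have fw: "f (w i) = Inr (xs ! i)" if "i < h" for i using that r by (simp add: f_def)
    have fe: "f u = Inl (e u)" "e u < k" if "u \<in> V - ?W" for u
      using that e by (auto simp: f_def bij_betw_def)
    have "adj u v \<longleftrightarrow> (f u, f v) \<in> parcs ?J" if uv: "u \<in> V" "v \<in> V" for u v
    proof (cases "u \<in> ?W"; cases "v \<in> ?W")
      assume "u \<in> ?W" "v \<in> ?W"
      thus ?thesis using adj arcs by (auto simp: fw parcs_join)
    next
      assume "u \<in> ?W" and v: "v \<notin> ?W"
      moreover have "adj u v" using univ[of v u] uv \<open>u \<in> ?W\<close> v adj_sym[of u v] by blast
      ultimately show ?thesis using fe[of v] uv by (auto simp: fw gF parcs_join)
    next
      assume u: "u \<notin> ?W" and "v \<in> ?W"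
      moreover have "adj u v" using univ[of u v] uv \<open>v \<in> ?W\<close> u by blast
      ultimately show ?thesis using fe[of u] uv by (auto simp: fw gF parcs_join)
    next
      assume u: "u \<notin> ?W" and v: "v \<notin> ?W"
      have "e u = e v \<longleftrightarrow> u = v" using e u v uv by (auto simp: bij_betw_def dest: inj_onD)
      thus ?thesis using fe[of u] fe[of v] uv u v univ[of u v] adj_irrefl by (auto simp: parcs_join)
    qed
    thus "G \<cong>\<^sub>g ?J" unfolding iso using f by blast
  qed
  thus ?thesis by (simp add: k_def)
qed

end

section \<open>The ten named graphs and their codes\<close>

lemma all_less_4: "(\<forall>i<4. P i) \<longleftrightarrow> P 0 \<and> P 1 \<and> P 2 \<and> P (3 :: nat)"
  by (auto simp: eval_nat_numeral less_Suc_eq)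

lemma lessThan_numerals:
  "{..<1::nat} = {0}" "{..<2::nat} = {0, 1}" "{..<3::nat} = {0, 1, 2}" "{..<4::nat} = {0, 1, 2, 3}"
  "{..<5::nat} = {0, 1, 2, 3, 4}"
  by auto

lemma represents_4I:
  assumes "pair_wf_digraph F" "distinct [a, b, c, d]" "{a, b, c, d} = pverts F"
    and "\<forall>i<4. \<forall>j<4. ([a, b, c, d] ! i, [a, b, c, d] ! j) \<in> parcs F \<longleftrightarrow> code_adj es i j"
  shows "represents es [a, b, c, d] F"
  using assms by (simp add: represents_def)

lemma represents_5I:
  assumes "pair_wf_digraph F" "distinct [a, b, c, d, e]" "{a, b, c, d, e} = pverts F"
    and "\<forall>i<5. \<forall>j<5. ([a, b, c, d, e] ! i, [a, b, c, d, e] ! j) \<in> parcs F \<longleftrightarrow> code_adj es i j"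
  shows "represents es [a, b, c, d, e] F"
  using assms by (simp add: represents_def)

lemma represents_codes4:
  "represents [] [(0, 0), (1, 0), (2, 0), (3, 0)] (4 \<cdot>\<^sub>g complete_graph 1)"
  "represents [(2, 3)] [Inl (0, 0), Inl (1, 0), Inr 0, Inr 1]
     ((2 \<cdot>\<^sub>g complete_graph 1) \<union>\<^sub>g complete_graph 2)"
  "represents [(0, 1), (1, 2)] [Inl 0, Inl 1, Inl 2, Inr 0] (path_graph 3 \<union>\<^sub>g complete_graph 1)"
  "represents [(0, 1), (2, 3)] [(0, 0), (0, 1), (1, 0), (1, 1)] (2 \<cdot>\<^sub>g complete_graph 2)"
  "represents [(0, 1), (1, 2), (2, 3)] [0, 1, 2, 3] (path_graph 4)"
  "represents [(0, 1), (1, 2), (0, 2)] [Inl 0, Inl 1, Inl 2, Inr 0] (complete_graph 3 \<union>\<^sub>g complete_graph 1)"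
  "represents [(0, 1), (1, 2), (2, 3), (0, 3)] [0, 1, 2, 3] (cycle_graph 4)"
  by (rule represents_4I, unfold_locales;
      auto simp: all_less_4 copies_def complete_graph_def path_graph_def cycle_graph_def
        disjoint_union_def lessThan_numerals code_adj_def; fail)+

lemma represents_codes5:
  "represents [(0, 1), (1, 2), (2, 3), (3, 4), (0, 4)] [0, 1, 2, 3, 4] (cycle_graph 5)"
  "represents [(1, 2), (2, 3), (3, 4)] [Inl 0, Inr 0, Inr 1, Inr 2, Inr 3] (complete_graph 1 \<union>\<^sub>g path_graph 4)"
  "represents [(0, 1), (1, 2), (0, 2), (0, 3), (1, 4)] [0, 1, 2, 3, 4] bull_graph"
  by (rule represents_5I, unfold_locales;
      auto simp: all_less_5 complete_graph_def path_graph_def cycle_graph_def bull_graph_def Let_def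
        disjoint_union_def lessThan_numerals code_adj_def; fail)+

text \<open>Symmetry and transitivity in one step, across three vertex types: follow
  \<open>g\<close> into \<open>J\<close> and return along the inverse of \<open>f\<close>.\<close>

lemma graph_iso_common_target:
  assumes wf: "pair_wf_digraph G" "pair_wf_digraph H" "pair_wf_digraph J"
    and iso: "G \<cong>\<^sub>g J" "H \<cong>\<^sub>g J"
  shows "H \<cong>\<^sub>g G"
proof -
  obtain f where f: "bij_betw f (pverts G) (pverts J)"
    and f_arcs: "\<And>u v. u \<in> pverts G \<Longrightarrow> v \<in> pverts G \<Longrightarrow> (u, v) \<in> parcs G \<longleftrightarrow> (f u, f v) \<in> parcs J"
    using iso(1) unfolding graph_iso_iff[OF wf(1,3)] by blast
  obtain g where g: "bij_betw g (pverts H) (pverts J)"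
    and g_arcs: "\<And>u v. u \<in> pverts H \<Longrightarrow> v \<in> pverts H \<Longrightarrow> (u, v) \<in> parcs H \<longleftrightarrow> (g u, g v) \<in> parcs J"
    using iso(2) unfolding graph_iso_iff[OF wf(2,3)] by blast
  define k where "k u = the_inv_into (pverts G) f (g u)" for u
  have k: "bij_betw k (pverts H) (pverts G)"
    using bij_betw_trans[OF g bij_betw_the_inv_into[OF f]] by (simp add: k_def[abs_def] o_def)
  have kG: "k u \<in> pverts G" "f (k u) = g u" if "u \<in> pverts H" for u
    using bij_betw_apply[OF k that] f_the_inv_into_f_bij_betw[OF f, of "g u"] bij_betw_apply[OF g that]
    by (auto simp: k_def)
  have "(u, v) \<in> parcs H \<longleftrightarrow> (k u, k v) \<in> parcs G" if "u \<in> pverts H" "v \<in> pverts H" for u v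
    using f_arcs[of "k u" "k v"] g_arcs[of u v] kG that by simp
  thus ?thesis unfolding graph_iso_iff[OF wf(2,1)] using k by blast
qed

text \<open>The code itself defines a model graph on the numbers below \<open>h\<close>; both graphs
  are isomorphic to its join with the same complete graph.\<close>

lemma cone_over_unique:
  assumes G: "finite_connected_graph G" and H: "finite_connected_graph H"
    and card: "card (pverts G) = card (pverts H)" "h \<le> card (pverts H)"
    and proper: "proper_code h es" and cone: "cone_over h es G" "cone_over h es H"
  shows "H \<cong>\<^sub>g G"
proof -
  define F where "F = \<lparr>pverts = {..<h}, parcs = {(i, j). i < h \<and> j < h \<and> code_adj es i j}\<rparr>"
  have F: "represents es [0..<h] F"
    unfolding represents_def
    by (intro conjI, unfold_locales) (auto simp: F_def)
  interpret G: finite_connected_graph G by (rule G)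
  interpret H: finite_connected_graph H by (rule H)
  let ?J = "complete_graph (card (pverts H) - h) \<or>\<^sub>g F"
  have "G \<cong>\<^sub>g ?J" "H \<cong>\<^sub>g ?J"
    using G.iso_join_iff_cone[OF F _ _ proper] H.iso_join_iff_cone[OF F _ _ proper] card cone by simp_all
  moreover have "pair_wf_digraph ?J" using F by (intro wf_join) (simp add: represents_def)
  moreover have "pair_wf_digraph G" "pair_wf_digraph H" by unfold_locales
  ultimately show ?thesis using graph_iso_common_target by blast
qed

context finite_connected_graph
begin

lemma iso_join_code_iff_cone:
  assumes "card V \<ge> 16" and "represents es xs F" "length xs = h" "(h, es) \<in> set codes"
  shows "G \<cong>\<^sub>g complete_graph (card V - h) \<or>\<^sub>g F \<longleftrightarrow> cone_over h es G"
proof (rule iso_join_iff_cone[OF assms(2,3)])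
  show "h \<le> card V" using assms(1,4) by (auto simp: codes_def)
  show "proper_code h es" by (rule proper_code_codes[OF assms(4)])
qed

lemma in_extremal_family_iff_cone:
  assumes n: "card V \<ge> 16"
  shows "in_extremal_family (card V) G \<longleftrightarrow> (\<exists>(h, es)\<in>set codes. cone_over h es G)"
proof -
  note iso = iso_join_code_iff_cone[OF n]
  have
    "G \<cong>\<^sub>g complete_graph (card V - 4) \<or>\<^sub>g (4 \<cdot>\<^sub>g complete_graph 1) \<longleftrightarrow> cone_over 4 [] G"
    "G \<cong>\<^sub>g complete_graph (card V - 4) \<or>\<^sub>g ((2 \<cdot>\<^sub>g complete_graph 1) \<union>\<^sub>g complete_graph 2) \<longleftrightarrow>
      cone_over 4 [(2, 3)] G"
    "G \<cong>\<^sub>g complete_graph (card V - 4) \<or>\<^sub>g (path_graph 3 \<union>\<^sub>g complete_graph 1) \<longleftrightarrow>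
      cone_over 4 [(0, 1), (1, 2)] G"
    "G \<cong>\<^sub>g complete_graph (card V - 4) \<or>\<^sub>g (2 \<cdot>\<^sub>g complete_graph 2) \<longleftrightarrow> cone_over 4 [(0, 1), (2, 3)] G"
    "G \<cong>\<^sub>g complete_graph (card V - 4) \<or>\<^sub>g path_graph 4 \<longleftrightarrow> cone_over 4 [(0, 1), (1, 2), (2, 3)] G"
    "G \<cong>\<^sub>g complete_graph (card V - 4) \<or>\<^sub>g (complete_graph 3 \<union>\<^sub>g complete_graph 1) \<longleftrightarrow>
      cone_over 4 [(0, 1), (1, 2), (0, 2)] G"
    "G \<cong>\<^sub>g complete_graph (card V - 4) \<or>\<^sub>g cycle_graph 4 \<longleftrightarrow>
      cone_over 4 [(0, 1), (1, 2), (2, 3), (0, 3)] G"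
    "G \<cong>\<^sub>g complete_graph (card V - 5) \<or>\<^sub>g cycle_graph 5 \<longleftrightarrow>
      cone_over 5 [(0, 1), (1, 2), (2, 3), (3, 4), (0, 4)] G"
    "G \<cong>\<^sub>g complete_graph (card V - 5) \<or>\<^sub>g (complete_graph 1 \<union>\<^sub>g path_graph 4) \<longleftrightarrow>
      cone_over 5 [(1, 2), (2, 3), (3, 4)] G"
    "G \<cong>\<^sub>g complete_graph (card V - 5) \<or>\<^sub>g bull_graph \<longleftrightarrow>
      cone_over 5 [(0, 1), (1, 2), (0, 2), (0, 3), (1, 4)] G"
    by ((rule iso, rule represents_codes4 represents_codes5, simp,
          simp add: codes_def codes4_def codes5_def)+)
  note iso = this
  show ?thesis
    unfolding in_extremal_family_def in_G1_def iso by (simp add: codes_def codes4_def codes5_def)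
qed

lemma A_multiplicity_iff_in_extremal_family:
  assumes n: "card V \<ge> 16"
  shows "A_multiplicity G (- 1) = card V - 5 \<longleftrightarrow> in_extremal_family (card V) G"
  using multiplicity_iff_cone[OF n] in_extremal_family_iff_cone[OF n]
  by (auto simp: A_multiplicity_def A_spectrum_eq codes_def)

end

lemma cones_cospectral:
  assumes G: "finite_connected_graph G" and H: "finite_connected_graph H"
    and card: "card (pverts G) = card (pverts H)" "card (pverts H) \<ge> 16"
    and spec: "A_spectrum H = A_spectrum G"
    and c: "(h, es) \<in> set codes" "cone_over h es G" and d: "(h', es') \<in> set codes" "cone_over h' es' H"
  shows "(h, es) = (h', es')"
proof (rule ccontr)
  assume neq: "(h, es) \<noteq> (h', es')"
  interpret G: finite_connected_graph G by (rule G)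
  interpret H: finite_connected_graph H by (rule H)
  let ?n = "card (pverts H)"
  have spec': "H.E.spec = G.E.spec" using spec by (simp add: G.A_spectrum_eq H.A_spectrum_eq)
  have h: "h < ?n" "h' < ?n" "2 \<le> ?n" using c(1) d(1) card by (auto simp: codes_def)
  note Gs = G.cone_power_sums[OF c(2) proper_code_codes[OF c(1)], unfolded card(1), OF h(1,3)]
  note Hs = H.cone_power_sums[OF d(2) proper_code_codes[OF d(1)] h(2,3)]
  have squares: "2 * code_sum h es + code_squares h es = 2 * code_sum h' es' + code_squares h' es'"
    using trans[OF Gs(1)[symmetric] Hs(1)[unfolded spec']] unfolding of_int_eq_iff by simp
  have cubes: "3 * int ?n * code_sum h es + code_cubes h es = 3 * int ?n * code_sum h' es' + code_cubes h' es'"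
    using trans[OF Gs(2)[symmetric] Hs(2)[unfolded spec']] unfolding of_int_eq_iff by simp
  have "\<not> separated (invariants (h, es)) (invariants (h', es'))"
    using separated_polynomials[OF card(2) _ squares] cubes unfolding invariants_def by auto
  hence "{(h, es), (h', es')} = {(4, [(0, 1), (1, 2), (2, 3)]), (4, [(0, 1), (1, 2), (0, 2)])}"
    by (rule mp[OF iffD1[OF disj_imp codes_separated[OF c(1) d(1) neq]]])
  from iffD1[OF doubleton_eq_iff this] show False
  proof (elim disjE conjE Pair_inject)
    assume eq: "h = 4" "es = [(0, 1), (1, 2), (2, 3)]" "h' = 4" "es' = [(0, 1), (1, 2), (0, 2)]"
    have "0 \<notin># G.E.spec" using G.cone_no_zero_eigenvalue c(2) card unfolding eq by simp
    moreover have "0 \<in># H.E.spec" using H.cone_zero_eigenvalue d(2) card unfolding eq by simp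
    ultimately show False unfolding spec' by contradiction
  next
    assume eq: "h = 4" "es = [(0, 1), (1, 2), (0, 2)]" "h' = 4" "es' = [(0, 1), (1, 2), (2, 3)]"
    have "0 \<in># G.E.spec" using G.cone_zero_eigenvalue c(2) card unfolding eq by simp
    moreover have "0 \<notin># H.E.spec" using H.cone_no_zero_eigenvalue d(2) card unfolding eq by simp
    ultimately show False unfolding spec' by contradiction
  qed
qed

theorem theorem3p5:
  fixes G :: "'a pair_pre_digraph" and n :: nat
  assumes "connected_graph G"
    and "card (pverts G) = n"
    and "n \<ge> 16"
  shows "(A_multiplicity G (-1) = n - 5 \<longleftrightarrow> in_extremal_family n G) \<and>
    (in_extremal_family n G \<longrightarrow> determined_by_A_spectrum TYPE('b) G)"
proof (intro conjI impI)
  have fG: "finite_connected_graph G" using assms(1) by unfold_locales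
  interpret G: finite_connected_graph G by (rule fG)
  show main: "A_multiplicity G (-1) = n - 5 \<longleftrightarrow> in_extremal_family n G"
    using G.A_multiplicity_iff_in_extremal_family assms by simp
  assume fam: "in_extremal_family n G"
  show "determined_by_A_spectrum TYPE('b) G"
    unfolding determined_by_A_spectrum_def
  proof (intro allI impI, elim conjE)
    fix H :: "'b pair_pre_digraph"
    assume H: "pair_graph H" "Digraph_Component.connected (with_proj H)"
      and spec: "A_spectrum H = A_spectrum G"
    have fH: "finite_connected_graph H" using H by unfold_locales auto
    interpret H: finite_connected_graph H by (rule fH)
    \<comment> \<open>The spectrum counts multiplicities, so its size is the order of the
      graph.\<close>
    have card: "card (pverts H) = n"
      using G.E.size_spec H.E.size_spec spec assms(2) by (simp add: G.A_spectrum_eq H.A_spectrum_eq)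
    \<comment> \<open>The multiplicity of -1 is read off the common spectrum, so the equivalence
      already shown applies to \<open>H\<close> as well.\<close>
    have "in_extremal_family n H"
      using H.A_multiplicity_iff_in_extremal_family card assms(3) main fam spec
      by (simp add: A_multiplicity_def)
    then obtain h' es' where d: "(h', es') \<in> set codes" "cone_over h' es' H"
      using H.in_extremal_family_iff_cone card assms(3) by auto
    obtain h es where c: "(h, es) \<in> set codes" "cone_over h es G"
      using G.in_extremal_family_iff_cone assms(2,3) fam by auto
    have "(h, es) = (h', es')"
      using cones_cospectral[OF fG fH _ _ spec c d] card assms by simp
    moreover have "h \<le> card (pverts H)" using c(1) card assms(3) by (auto simp: codes_def)
    ultimately show "H \<cong>\<^sub>g G"
      using cone_over_unique[OF fG fH _ _ proper_code_codes[OF c(1)] c(2)] d(2) card assms(2) by simp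
  qed
qed

end
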